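(* Let $\mathcal H=\bigcup_{\alpha\in\Lambda}\mathcal K_\alpha$ be a locally Hilbert space, let $\mathcal A$ be a locally $C^*$-subalgebra of $B_{loc}(\mathcal H)$, and let $\mathfrak A=\overline{\mathcal A}^{SOT}$. Then: (1) $\mathcal A_{sa}$ is SOT-dense in $\mathfrak A_{sa}$; (2) for every real number $M>0$, $$\overline{\{a\in\mathcal A_{sa}:\ \|a|_{\mathcal K_\alpha}\|_{B(\mathcal K_\alpha)}\le M\ \ \forall\alpha\in\Lambda\}}^{SOT}=\{T\in\mathfrak A_{sa}:\ \|T|_{\mathcal K_\alpha}\|_{B(\mathcal K_\alpha)}\le M\ \ \forall\alpha\in\Lambda\}.$$
   Context: A locally Hilbert space is $\mathcal H=\bigcup_{\alpha\in\Lambda}\mathcal K_\alpha$ ($\Lambda$ directed, $\mathcal K_\alpha$ Hilbert spaces, $\mathcal K_\alpha$ a closed subspace of $\mathcal K_\beta$ for $\alpha\le\beta$) with the inductive limit topology. $B_{loc}(\mathcal H)$ is the $*$-algebra of linear maps $T:\mathcal H\to\mathcal H$ with $T(\mathcal K_\alpha)\subseteq\mathcal K_\alpha$, $T|_{\mathcal K_\alpha}\in B(\mathcal K_\alpha)$, compatible with the orthogonal projections $\mathcal K_\beta\to\mathcal K_\alpha$, with involution $(T^* )|_{\mathcal K_\alpha}=(T|_{\mathcal K_\alpha})^*$ and topology given by the seminorms $T\mapsto\|T|_{\mathcal K_\alpha}\|$. A locally $C^*$-subalgebra is a closed $*$-subalgebra (which is then a complete locally convex $*$-algebra whose seminorms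 satisfy $p(xy)\le p(x)p(y)$, $p(x^* )=p(x)$, $p(x^*x)=p(x)^2$). For a subset $X$, $X_{sa}$ denotes its self-adjoint elements. SOT is generated by the seminorms $T\mapsto\|Th\|$, $h\in\mathcal H$. *)

theory Defs
  imports "HOL-Analysis.Analysis"
begin

class complex_inner = real_normed_vector +
  fixes scaleC :: "complex \<Rightarrow> 'a \<Rightarrow> 'a"
  fixes cinner :: "'a \<Rightarrow> 'a \<Rightarrow> complex"
  assumes scaleC_add_right: "scaleC c (x + y) = scaleC c x + scaleC c y"
    and scaleC_add_left: "scaleC (c + d) x = scaleC c x + scaleC d x"
    and scaleC_scaleC: "scaleC c (scaleC d x) = scaleC (c * d) x"
    and scaleC_one: "scaleC 1 x = x"
    and scaleC_of_real: "scaleC (complex_of_real r) x = scaleR r x"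
    and cinner_conj: "cinner x y = cnj (cinner y x)"
    and cinner_add_right: "cinner x (y + z) = cinner x y + cinner x z"
    and cinner_scaleC_right: "cinner x (scaleC c y) = c * cinner x y"
    and cinner_self_nonneg: "0 \<le> Re (cinner x x)"
    and cinner_self_zero: "cinner x x = 0 \<Longrightarrow> x = 0"
    and norm_cinner: "norm x = sqrt (Re (cinner x x))"

instantiation complex :: complex_inner
begin
definition scaleC_complex :: "complex \<Rightarrow> complex \<Rightarrow> complex" where "scaleC_complex c x = c * x"
definition cinner_complex :: "complex \<Rightarrow> complex \<Rightarrow> complex" where "cinner_complex x y = cnj x * y"
instance
proof
  fix x y z c d :: complex and r :: real
  show "scaleC c (x + y) = scaleC c x + scaleC c y" by (simp add: scaleC_complex_def algebra_simps)
  show "scaleC (c + d) x = scaleC c x + scaleC d x" by (simp add: scaleC_complex_def algebra_simps)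
  show "scaleC c (scaleC d x) = scaleC (c * d) x" by (simp add: scaleC_complex_def algebra_simps)
  show "scaleC 1 x = x" by (simp add: scaleC_complex_def)
  show "scaleC (complex_of_real r) x = scaleR r x" by (simp add: scaleC_complex_def scaleR_conv_of_real)
  show "cinner x y = cnj (cinner y x)" by (simp add: cinner_complex_def)
  show "cinner x (y + z) = cinner x y + cinner x z" by (simp add: cinner_complex_def algebra_simps)
  show "cinner x (scaleC c y) = c * cinner x y" by (simp add: cinner_complex_def scaleC_complex_def algebra_simps)
  show "0 \<le> Re (cinner x x)" by (simp add: cinner_complex_def)
  show "cinner x x = 0 \<Longrightarrow> x = 0" by (simp add: cinner_complex_def)
  show "norm x = sqrt (Re (cinner x x))" by (simp add: cinner_complex_def norm_complex_def power2_eq_square)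
qed
end

definition csubspace :: "'h::complex_inner set \<Rightarrow> bool" where
  "csubspace S \<longleftrightarrow> 0 \<in> S \<and> (\<forall>x\<in>S. \<forall>y\<in>S. x + y \<in> S) \<and> (\<forall>c. \<forall>x\<in>S. scaleC c x \<in> S)"

text \<open>Locally Hilbert space: H = UNION of the K a (here the whole type), over a
  directed index set; each K a is a complete (Hilbert) subspace, increasing in a
  (hence K a is a closed subspace of K b for a \<le> b).\<close>
definition locally_hilbert :: "('i::preorder \<Rightarrow> 'h::complex_inner set) \<Rightarrow> bool" where
  "locally_hilbert K \<longleftrightarrow>
     (\<forall>a b::'i. \<exists>c. a \<le> c \<and> b \<le> c) \<and>
     (\<forall>a. csubspace (K a) \<and> complete (K a)) \<and>
     (\<forall>a b. a \<le> b \<longrightarrow> K a \<subseteq> K b) \<and>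
     (\<Union>a. K a) = UNIV"

definition orth_proj :: "'h::complex_inner set \<Rightarrow> 'h \<Rightarrow> 'h" where
  "orth_proj S x = (THE y. y \<in> S \<and> (\<forall>z\<in>S. cinner z (x - y) = 0))"

definition is_bloc :: "('i::preorder \<Rightarrow> 'h::complex_inner set) \<Rightarrow> ('h \<Rightarrow> 'h) \<Rightarrow> bool" where
  "is_bloc K T \<longleftrightarrow>
     (\<forall>x y. T (x + y) = T x + T y) \<and> (\<forall>c x. T (scaleC c x) = scaleC c (T x)) \<and>
     (\<forall>a. T ` K a \<subseteq> K a \<and> (\<exists>C. \<forall>x\<in>K a. norm (T x) \<le> C * norm x)) \<and>
     (\<forall>a b. a \<le> b \<longrightarrow> (\<forall>x\<in>K b. orth_proj (K a) (T x) = T (orth_proj (K a) x)))"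

definition bloc_adj :: "('i::preorder \<Rightarrow> 'h::complex_inner set) \<Rightarrow> ('h \<Rightarrow> 'h) \<Rightarrow> 'h \<Rightarrow> 'h" where
  "bloc_adj K T x = (THE y. \<exists>a. x \<in> K a \<and> y \<in> K a \<and> (\<forall>z\<in>K a. cinner (T z) x = cinner z y))"

definition loc_norm :: "('i \<Rightarrow> 'h::complex_inner set) \<Rightarrow> ('h \<Rightarrow> 'h) \<Rightarrow> 'i \<Rightarrow> real" where
  "loc_norm K T a = (SUP x\<in>{x \<in> K a. norm x \<le> 1}. norm (T x))"

text \<open>Locally C*-subalgebra: a *-subalgebra of B_loc(H) closed in the topology
  generated by the seminorms loc_norm K _ a.\<close>
definition locally_C_star_subalg :: "('i::preorder \<Rightarrow> 'h::complex_inner set) \<Rightarrow> ('h \<Rightarrow> 'h) set \<Rightarrow> bool" where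
  "locally_C_star_subalg K A \<longleftrightarrow>
     A \<subseteq> {T. is_bloc K T} \<and> (\<lambda>x. 0) \<in> A \<and>
     (\<forall>S\<in>A. \<forall>T\<in>A. (\<lambda>x. S x + T x) \<in> A) \<and>
     (\<forall>c. \<forall>T\<in>A. (\<lambda>x. scaleC c (T x)) \<in> A) \<and>
     (\<forall>S\<in>A. \<forall>T\<in>A. S \<circ> T \<in> A) \<and>
     (\<forall>T\<in>A. bloc_adj K T \<in> A) \<and>
     (\<forall>T. is_bloc K T \<and>
        (\<forall>F \<epsilon>. finite F \<longrightarrow> \<epsilon> > 0 \<longrightarrow> (\<exists>S\<in>A. \<forall>a\<in>F. loc_norm K (\<lambda>x. T x - S x) a < \<epsilon>))
        \<longrightarrow> T \<in> A)"

definition sot_closure :: "('i::preorder \<Rightarrow> 'h::complex_inner set) \<Rightarrow> ('h \<Rightarrow> 'h) set \<Rightarrow> ('h \<Rightarrow> 'h) set" where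
  "sot_closure K X = {T. is_bloc K T \<and>
     (\<forall>F \<epsilon>. finite F \<longrightarrow> \<epsilon> > 0 \<longrightarrow> (\<exists>S\<in>X. \<forall>h\<in>F. norm (T h - S h) < \<epsilon>))}"

definition sa_part :: "('i::preorder \<Rightarrow> 'h::complex_inner set) \<Rightarrow> ('h \<Rightarrow> 'h) set \<Rightarrow> ('h \<Rightarrow> 'h) set" where
  "sa_part K X = {T \<in> X. bloc_adj K T = T}"

end

theory Submission
  imports Defs
begin

text \<open>For (1), the evaluations of self-adjoint elements of the algebra on a finite set of vectors form
  a real subspace of a finite power of some \<open>K a\<close>; a functional orthogonal to it also kills the
  evaluation of \<open>T\<close>, because the adjoint is continuous for the weak operator topology.

  For (2), Kaplansky's map \<open>S \<mapsto> 2 S (1 + S\<^sup>2)\<inverse>\<close> is SOT continuous on self-adjoint operators, has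
  values of norm at most 1 on every \<open>K a\<close> and preserves the algebra. If \<open>\<parallel>T\<parallel> \<le> r < 1\<close>, polynomials in
  \<open>T\<close> given by a contractive iteration are approximate preimages of \<open>T\<close>. No spectral calculus is
  needed: \<open>(1 + S\<^sup>2)\<inverse>\<close> comes from Banach's fixed point theorem on each \<open>K a\<close>.\<close>

section \<open>The real inner product\<close>

text \<open>The space \<open>'h\<close> need not be complete, so Riesz representation, projections
  and fixed points are obtained inside one \<open>K a\<close>; uniqueness or compatibility with the
  projections glues the results. Self-adjoint elements form only a real vector space, hence a real
  inner product. The approximants of (1) come without norm control. The function t -> 2t/(1+t^2)
  supplies it, since it maps the reals into [-1,1], and the estimates behind its continuity contain
  no norm of the approximants. The algebra need not have a unit, so (1+S^2)^-1 may lie outside it.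
  The transform G itself satisfies (1+S^2) G = 2 S, and iterates for this equation started at 0 are
  polynomials in S without constant term. On [-1,1] the function has an inverse, but its derivative
  vanishes at the endpoints; this is why preimages are sought for r T with r < 1, and r tends to 1
  only at the end.\<close>

definition rcinner :: "'h::complex_inner \<Rightarrow> 'h \<Rightarrow> real" where
  "rcinner x y = Re (cinner x y)"

lemma cinner_add_left: "cinner (x + y) z = cinner x z + cinner (y::'h::complex_inner) z"
  by (metis cinner_conj cinner_add_right complex_cnj_add)

lemma cinner_scaleC_left: "cinner (scaleC c x) (y::'h::complex_inner) = cnj c * cinner x y"
  by (metis cinner_conj cinner_scaleC_right complex_cnj_mult)

lemma rcinner_commute: "rcinner x y = rcinner y (x::'h::complex_inner)"
  unfolding rcinner_def by (subst cinner_conj) simp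

lemma rcinner_self: "rcinner x x = (norm (x::'h::complex_inner))\<^sup>2"
  by (simp add: rcinner_def norm_cinner cinner_self_nonneg)

lemma rcinner_add_right: "rcinner x (y + z) = rcinner x y + rcinner x (z::'h::complex_inner)"
  by (simp add: rcinner_def cinner_add_right)

lemma rcinner_add_left: "rcinner (x + y) z = rcinner x z + rcinner y (z::'h::complex_inner)"
  by (simp add: rcinner_def cinner_add_left)

lemma rcinner_scaleR_right: "rcinner x (r *\<^sub>R y) = r * rcinner x (y::'h::complex_inner)"
  by (simp add: rcinner_def cinner_scaleC_right flip: scaleC_of_real)

lemma rcinner_scaleR_left: "rcinner (r *\<^sub>R x) y = r * rcinner x (y::'h::complex_inner)"
  by (metis rcinner_commute rcinner_scaleR_right)

lemma norm_add_sq: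
  "(norm (x + y))\<^sup>2 = (norm x)\<^sup>2 + 2 * rcinner x y + (norm (y::'h::complex_inner))\<^sup>2"
  by (simp add: rcinner_add_left rcinner_add_right rcinner_commute[of y x] flip: rcinner_self)

lemma rcinner_le: "rcinner x y \<le> norm x * norm (y::'h::complex_inner)"
proof -
  have "(norm (x + y))\<^sup>2 \<le> (norm x + norm y)\<^sup>2"
    by (simp add: norm_triangle_ineq power_mono)
  then show ?thesis by (simp add: norm_add_sq power2_sum)
qed

lemma abs_rcinner_le: "\<bar>rcinner x y\<bar> \<le> norm x * norm (y::'h::complex_inner)"
  using rcinner_le[of x y] rcinner_le[of "- x" y] rcinner_scaleR_left[of "-1" x y] by simp

interpretation rcinner: bounded_bilinear rcinner
  by standard (auto simp: rcinner_add_left rcinner_add_right rcinner_scaleR_left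
      rcinner_scaleR_right intro!: exI[of _ 1] abs_rcinner_le)

lemma norm_diff_sq:
  "(norm (x - y))\<^sup>2 = (norm x)\<^sup>2 - 2 * rcinner x y + (norm (y::'h::complex_inner))\<^sup>2"
  by (simp add: rcinner.diff_left rcinner.diff_right rcinner_commute[of y x] flip: rcinner_self)

lemma rcinner_eqI:
  fixes x y :: "'h::complex_inner"
  assumes "\<And>z. rcinner z x = rcinner z y"
  shows "x = y"
proof -
  have "rcinner (x - y) (x - y) = 0" using assms by (simp add: rcinner.diff_right)
  then show ?thesis by (simp add: rcinner_self)
qed

lemma Im_cinner: "Im (cinner z x) = rcinner (scaleC \<i> z) (x::'h::complex_inner)"
  by (simp add: rcinner_def cinner_scaleC_left)

lemma cinner_zero_right: "cinner z (0::'h::complex_inner) = 0"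
  using cinner_add_right[of z 0 0] by simp

lemma csubspace_scaleR: "csubspace S \<Longrightarrow> x \<in> S \<Longrightarrow> r *\<^sub>R x \<in> S"
  unfolding csubspace_def by (metis scaleC_of_real)

lemma csubspace_add: "csubspace S \<Longrightarrow> x \<in> S \<Longrightarrow> y \<in> S \<Longrightarrow> x + y \<in> S"
  unfolding csubspace_def by blast

lemma csubspace_diff: "csubspace S \<Longrightarrow> x \<in> S \<Longrightarrow> y \<in> S \<Longrightarrow> x - y \<in> S"
  using csubspace_add[of S x "(-1) *\<^sub>R y"] csubspace_scaleR[of S y "-1"] by simp

text \<open>Imaginary parts are real parts at \<open>scaleC \<i> z\<close>, so on a complex subspace
  nothing is lost by passing to \<open>rcinner\<close>.\<close>

lemma csubspace_cinner_eq_iff: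
  assumes "csubspace S"
  shows "(\<forall>z\<in>S. cinner z x = cinner z y) \<longleftrightarrow> (\<forall>z\<in>S. rcinner z x = rcinner z y)"
proof
  assume r: "\<forall>z\<in>S. rcinner z x = rcinner z y"
  show "\<forall>z\<in>S. cinner z x = cinner z y"
  proof
    fix z assume z: "z \<in> S"
    then have "scaleC \<i> z \<in> S" using assms by (simp add: csubspace_def)
    with z r show "cinner z x = cinner z y"
      by (intro complex_eqI) (auto simp: Im_cinner simp flip: rcinner_def)
  qed
qed (simp add: rcinner_def)

text \<open>The first-order condition at a minimiser: \<open>c\<close> is the first variation,
  \<open>N\<close> the quadratic term.\<close>

lemma linear_coeff_zero_of_nonneg:
  fixes c N :: real
  assumes "\<And>r. 0 \<le> 2 * r * c + r\<^sup>2 * N" and "0 \<le> N"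
  shows "c = 0"
proof -
  \<comment> \<open>The natural choice - c / N is replaced by one that survives
    \<open>N = 0\<close>.\<close>
  define r where "r = - c / (N + 1)"
  have c: "c = - r * (N + 1)" using assms(2) by (simp add: r_def)
  have "0 \<le> - (r\<^sup>2 * (N + 2))"
    using assms(1)[of r] by (simp add: c power2_eq_square algebra_simps)
  then have "r = 0" using assms(2) by (simp add: mult_le_0_iff)
  then show ?thesis by (simp add: c)
qed

text \<open>The minimiser of \<open>f \<mapsto> (\<Sum>b\<in>F. norm (f b)\<^sup>2) - 2 * \<phi> f\<close> in the closure of \<open>D\<close>
  represents \<open>\<phi>\<close>. Allowing families of vectors indexed by \<open>F\<close> replaces finite direct sums of
  Hilbert spaces.\<close>

lemma riesz_family:
  fixes D :: "('b \<Rightarrow> 'h::complex_inner) set" and \<phi> :: "('b \<Rightarrow> 'h) \<Rightarrow> real"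
  assumes fin: "finite F" and comp: "complete V" and ne: "D \<noteq> {}"
    and DV: "\<And>f b. f \<in> D \<Longrightarrow> b \<in> F \<Longrightarrow> f b \<in> V"
    and Dadd: "\<And>f g. f \<in> D \<Longrightarrow> g \<in> D \<Longrightarrow> (\<lambda>b. f b + g b) \<in> D"
    and Dscale: "\<And>f r. f \<in> D \<Longrightarrow> (\<lambda>b. r *\<^sub>R f b) \<in> D"
    and padd: "\<And>f g. f \<in> D \<Longrightarrow> g \<in> D \<Longrightarrow> \<phi> (\<lambda>b. f b + g b) = \<phi> f + \<phi> g"
    and pscale: "\<And>f r. f \<in> D \<Longrightarrow> \<phi> (\<lambda>b. r *\<^sub>R f b) = r * \<phi> f"
    and bound: "\<And>f. f \<in> D \<Longrightarrow> C \<le> (\<Sum>b\<in>F. (norm (f b))\<^sup>2) - 2 * \<phi> f"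
  obtains w where "\<And>b. b \<in> F \<Longrightarrow> w b \<in> V"
    and "\<And>\<epsilon>. \<epsilon> > 0 \<Longrightarrow> \<exists>f\<in>D. \<forall>b\<in>F. norm (f b - w b) < \<epsilon>"
    and "\<And>f. f \<in> D \<Longrightarrow> \<phi> f = (\<Sum>b\<in>F. rcinner (w b) (f b))"
proof -
  define N where "N f = (\<Sum>b\<in>F. (norm (f b))\<^sup>2)" for f :: "'b \<Rightarrow> 'h"
  define J where "J f = N f - 2 * \<phi> f" for f
  define d where "d = (INF f\<in>D. J f)"
  have N0: "0 \<le> N f" for f by (simp add: N_def sum_nonneg)
  have bdd: "bdd_below (J ` D)"
    using bound by (intro bdd_belowI[of _ C]) (auto simp: J_def N_def)
  have dle: "d \<le> J f" if "f \<in> D" for f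
    unfolding d_def using bdd that by (rule cINF_lower)
  have "\<exists>f\<in>D. J f < d + inverse (real (Suc n))" for n
  proof -
    have "(INF f\<in>D. J f) < d + inverse (real (Suc n))" by (simp add: d_def)
    then show ?thesis using cINF_less_iff[OF ne bdd] by blast
  qed
  then obtain f where fD: "\<And>n. f n \<in> D" and fJ: "\<And>n. J (f n) < d + inverse (real (Suc n))"
    by metis
  \<comment> \<open>Parallelogram identity: the linear terms of \<open>J\<close> cancel at the
    midpoint, so near-minimisers are close to each other and minimising sequences are
    Cauchy.\<close>
  have par: "N (\<lambda>b. g b - h b) \<le> 2 * (J g - d) + 2 * (J h - d)" if g: "g \<in> D" and h: "h \<in> D" for g h
  proof -
    define m where "m = (\<lambda>b. (1/2) *\<^sub>R (g b + h b))"
    have gh: "(\<lambda>b. g b + h b) \<in> D" using g h by (rule Dadd)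
    have m: "m \<in> D" unfolding m_def by (rule Dscale[OF gh])
    have pm: "\<phi> m = (\<phi> g + \<phi> h) / 2"
      unfolding m_def by (subst pscale[OF gh]) (simp add: padd[OF g h])
    have "(norm (g b - h b))\<^sup>2 = 2 * (norm (g b))\<^sup>2 + 2 * (norm (h b))\<^sup>2 - 4 * (norm (m b))\<^sup>2" for b
      by (simp add: m_def norm_add_sq norm_diff_sq power_mult_distrib power_divide add_divide_distrib)
    then have "N (\<lambda>b. g b - h b) = 2 * N g + 2 * N h - 4 * N m"
      by (simp add: N_def sum.distrib sum_subtractf sum_distrib_left)
    then show ?thesis using dle[OF m] pm by (simp add: J_def add_divide_distrib)
  qed
  have conv: "\<exists>l\<in>V. (\<lambda>n. f n b) \<longlonglongrightarrow> l" if b: "b \<in> F" for b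
  proof -
    have "Cauchy (\<lambda>n. f n b)"
    proof (rule CauchyI)
      fix e :: real assume e: "0 < e"
      obtain M where M: "inverse (real (Suc M)) < e\<^sup>2 / 4"
        using reals_Archimedean[of "e\<^sup>2 / 4"] e by auto
      show "\<exists>M. \<forall>m\<ge>M. \<forall>n\<ge>M. norm (f m b - f n b) < e"
      proof (intro exI allI impI)
        fix m n assume mn: "m \<ge> M" "n \<ge> M"
        have i: "J (f k) < d + e\<^sup>2 / 4" if "k \<ge> M" for k
        proof -
          have "inverse (real (Suc k)) \<le> inverse (real (Suc M))"
            using that by (intro le_imp_inverse_le) auto
          then have "d + inverse (real (Suc k)) < d + e\<^sup>2 / 4"
            using M by (rule add_strict_left_mono[OF le_less_trans])
          with fJ[of k] show ?thesis by (rule less_trans)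
        qed
        have "(norm (f m b - f n b))\<^sup>2 \<le> N (\<lambda>b. f m b - f n b)"
          unfolding N_def using fin b by (intro member_le_sum) auto
        also have "\<dots> \<le> 2 * (J (f m) - d) + 2 * (J (f n) - d)" by (rule par[OF fD fD])
        also have "\<dots> < e\<^sup>2" using i[OF mn(1)] i[OF mn(2)] by argo
        finally show "norm (f m b - f n b) < e" using e by (simp add: power_less_imp_less_base)
      qed
    qed
    then show ?thesis using comp DV[OF fD b] by (auto simp: complete_def)
  qed
  then obtain w where wV: "\<And>b. b \<in> F \<Longrightarrow> w b \<in> V"
    and lim: "\<And>b. b \<in> F \<Longrightarrow> (\<lambda>n. f n b) \<longlonglongrightarrow> w b"
    by metis
  have approx: "\<exists>f\<in>D. \<forall>b\<in>F. norm (f b - w b) < \<epsilon>" if "\<epsilon> > 0" for \<epsilon>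
  proof -
    have "\<forall>\<^sub>F n in sequentially. \<forall>b\<in>F. dist (f n b) (w b) < \<epsilon>"
      using fin lim that by (auto intro!: eventually_ball_finite dest: tendstoD)
    then obtain n where "\<forall>b\<in>F. dist (f n b) (w b) < \<epsilon>"
      by (auto simp: eventually_sequentially)
    then show ?thesis using fD by (auto simp: dist_norm)
  qed
  have rep: "\<phi> g = (\<Sum>b\<in>F. rcinner (w b) (g b))" if g: "g \<in> D" for g
  proof -
    \<comment> \<open>First variation at \<open>w\<close> in direction \<open>g\<close>. Since
      \<open>w\<close> may lie outside \<open>D\<close>, the inequality is proved at
      \<open>f n\<close> with error 1/(n+1) and then passed to the limit.\<close>
    have "0 \<le> 2 * r * ((\<Sum>b\<in>F. rcinner (w b) (g b)) - \<phi> g) + r\<^sup>2 * N g" for r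
    proof -
      have *: "0 \<le> inverse (real (Suc n))
          + (2 * r * ((\<Sum>b\<in>F. rcinner (f n b) (g b)) - \<phi> g) + r\<^sup>2 * N g)" for n
      proof -
        have rg: "(\<lambda>b. r *\<^sub>R g b) \<in> D" using g by (rule Dscale)
        have "N (\<lambda>b. f n b + r *\<^sub>R g b)
            = N (f n) + 2 * r * (\<Sum>b\<in>F. rcinner (f n b) (g b)) + r\<^sup>2 * N g"
          by (simp add: N_def norm_add_sq rcinner.scaleR_right power_mult_distrib sum.distrib
              sum_distrib_left mult.assoc)
        moreover have "\<phi> (\<lambda>b. f n b + r *\<^sub>R g b) = \<phi> (f n) + r * \<phi> g"
          by (simp add: padd[OF fD rg] pscale[OF g])
        ultimately show ?thesis
          using dle[OF Dadd[OF fD rg, of n]] fJ[of n] by (simp add: J_def algebra_simps)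
      qed
      have "(\<lambda>n. inverse (real (Suc n))
          + (2 * r * ((\<Sum>b\<in>F. rcinner (f n b) (g b)) - \<phi> g) + r\<^sup>2 * N g))
        \<longlonglongrightarrow> 0 + (2 * r * ((\<Sum>b\<in>F. rcinner (w b) (g b)) - \<phi> g) + r\<^sup>2 * N g)"
        by (intro tendsto_intros LIMSEQ_inverse_real_of_nat rcinner.tendsto lim)
      from LIMSEQ_le_const[OF this] * show ?thesis by auto
    qed
    from linear_coeff_zero_of_nonneg[OF this N0] show ?thesis by simp
  qed
  from that[OF wV approx rep] show ?thesis by blast
qed

text \<open>The case of a one-element index set. A one-sided bound is enough, because it already
  bounds the quadratic functional from below.\<close>

lemma riesz:
  fixes V :: "'h::complex_inner set" and \<phi> :: "'h \<Rightarrow> real"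
  assumes sub: "csubspace V" and comp: "complete V"
    and padd: "\<And>x y. \<phi> (x + y) = \<phi> x + \<phi> y"
    and pscale: "\<And>x r. \<phi> (r *\<^sub>R x) = r * \<phi> x"
    and bound: "\<And>x. x \<in> V \<Longrightarrow> \<phi> x \<le> C * norm x"
  obtains w where "w \<in> V" and "\<And>x. x \<in> V \<Longrightarrow> \<phi> x = rcinner x w"
proof -
  have *: "- (C\<^sup>2) \<le> (norm x)\<^sup>2 - 2 * \<phi> x" if "x \<in> V" for x
  proof -
    have "0 \<le> (norm x - C)\<^sup>2" by simp
    then show ?thesis using bound[OF that] by (simp add: power2_diff algebra_simps)
  qed
  have "0 \<in> V" using sub by (simp add: csubspace_def)
  define D where "D = {f :: unit \<Rightarrow> 'h. f () \<in> V}"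
  have D: "D \<noteq> {}" using \<open>0 \<in> V\<close> by (auto simp: D_def)
  obtain w where w: "\<And>b. b \<in> {()} \<Longrightarrow> w b \<in> V"
    and rep: "\<And>f. f \<in> D \<Longrightarrow> \<phi> (f ()) = (\<Sum>b\<in>{()}. rcinner (w b) (f b))"
  proof (rule riesz_family[of "{()}" V D "\<lambda>f. \<phi> (f ())" "- (C\<^sup>2)"], goal_cases)
    case (4 f b) then show ?case by (simp add: D_def)
  next
    case (5 f g) then show ?case by (simp add: D_def csubspace_add[OF sub])
  next
    case (6 f r) then show ?case by (simp add: D_def csubspace_scaleR[OF sub])
  next
    case (9 f) then show ?case using *[of "f ()"] by (simp add: D_def)
  qed (use comp D in \<open>simp_all add: padd pscale\<close>)
  show ?thesis
  proof (rule that)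
    show "w () \<in> V" by (simp add: w)
    show "\<phi> x = rcinner x (w ())" if "x \<in> V" for x
      using rep[of "\<lambda>_. x"] that by (simp add: D_def rcinner_commute)
  qed
qed

section \<open>The algebra of local operators\<close>

locale locally_hilbert_space =
  fixes K :: "'i::preorder \<Rightarrow> 'h::complex_inner set"
  assumes locally_hilbert: "locally_hilbert K"
begin

lemma sub_K: "csubspace (K a)" and complete_K: "complete (K a)"
  and mono_K: "a \<le> b \<Longrightarrow> K a \<subseteq> K b"
  using locally_hilbert by (auto simp: locally_hilbert_def)

lemma zero_K: "0 \<in> K a"
  using sub_K by (simp add: csubspace_def)

lemma finite_upper: "finite I \<Longrightarrow> \<exists>c. \<forall>a\<in>I. a \<le> (c::'i)"
proof (induction I rule: finite_induct)
  case (insert a I)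
  then obtain c where c: "\<forall>a\<in>I. a \<le> c" by blast
  obtain e where "a \<le> e" "c \<le> e" using locally_hilbert unfolding locally_hilbert_def by blast
  with c show ?case by (auto intro: order_trans)
qed simp

text \<open>A basic SOT neighbourhood tests finitely many vectors; directedness puts them all into
  one complete \<open>K a\<close>.\<close>

lemma finite_subset_K:
  assumes "finite F"
  obtains a where "F \<subseteq> K a"
proof -
  have "\<exists>a. x \<in> K a" for x using locally_hilbert unfolding locally_hilbert_def by blast
  then obtain i where i: "\<And>x. x \<in> K (i x)" by metis
  obtain c where c: "\<forall>a\<in>i ` F. a \<le> c" using finite_upper[of "i ` F"] assms by blast
  then have "F \<subseteq> K c" using i mono_K by fastforce
  then show ?thesis by (rule that)
qed

section \<open>Orthogonal projections onto the subspaces \<open>K a\<close>\<close>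

lemma orth_proj_unique:
  assumes "y \<in> K a" "\<And>z. z \<in> K a \<Longrightarrow> rcinner z (x - y) = 0"
  shows "orth_proj (K a) x = y"
  unfolding orth_proj_def
proof (rule the_equality)
  have "\<forall>z\<in>K a. cinner z (x - y) = cinner z 0"
    using csubspace_cinner_eq_iff[OF sub_K, of a "x - y" 0] assms by (simp add: rcinner.zero_right)
  then show "y \<in> K a \<and> (\<forall>z\<in>K a. cinner z (x - y) = 0)"
    using assms(1) by (simp add: cinner_zero_right)
next
  fix y' assume y': "y' \<in> K a \<and> (\<forall>z\<in>K a. cinner z (x - y') = 0)"
  then have d: "y' - y \<in> K a" using assms(1) sub_K csubspace_diff by blast
  then have "rcinner (y' - y) (x - y') = 0" using y' by (simp add: rcinner_def)
  moreover have "rcinner (y' - y) (x - y) = 0" using assms(2) d by blast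
  ultimately have "rcinner (y' - y) (y' - y) = 0" by (simp add: rcinner.diff_right)
  then show "y' = y" by (simp add: rcinner_self)
qed

text \<open>The projection is the Riesz vector in \<open>K a\<close> of the functional
  \<open>\<lambda>z. rcinner z x\<close>; only \<open>K a\<close> has to be complete.\<close>

lemma orth_proj:
  shows orth_proj_in: "orth_proj (K a) x \<in> K a"
    and orth_proj_orth: "z \<in> K a \<Longrightarrow> rcinner z (orth_proj (K a) x) = rcinner z x"
proof -
  obtain w where w: "w \<in> K a" "\<And>z. z \<in> K a \<Longrightarrow> rcinner z x = rcinner z w"
    by (rule riesz[OF sub_K complete_K, where \<phi> = "\<lambda>z. rcinner z x" and C = "norm x"])
       (use rcinner_le[of _ x] in \<open>auto simp: rcinner.add_left rcinner.scaleR_left mult.commute\<close>)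
  then have "orth_proj (K a) x = w" by (intro orth_proj_unique) (auto simp: rcinner.diff_right)
  with w show "orth_proj (K a) x \<in> K a" "z \<in> K a \<Longrightarrow> rcinner z (orth_proj (K a) x) = rcinner z x"
    by auto
qed

lemma orth_proj_eqI:
  assumes "y \<in> K a" "\<And>z. z \<in> K a \<Longrightarrow> rcinner z x = rcinner z y"
  shows "orth_proj (K a) x = y"
  using assms by (intro orth_proj_unique) (auto simp: rcinner.diff_right)

lemma orth_proj_add: "orth_proj (K a) (x + y) = orth_proj (K a) x + orth_proj (K a) y"
  by (rule orth_proj_eqI)
     (auto simp: orth_proj_in orth_proj_orth rcinner.add_right intro: csubspace_add[OF sub_K])

lemma rcinner_scaleC_right: "rcinner z (scaleC c x) = rcinner (scaleC (cnj c) z) (x::'h)"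
  by (simp add: rcinner_def cinner_scaleC_left cinner_scaleC_right)

lemma orth_proj_scaleC: "orth_proj (K a) (scaleC c x) = scaleC c (orth_proj (K a) x)"
proof (rule orth_proj_eqI)
  have c: "scaleC e y \<in> K a" if "y \<in> K a" for e y using sub_K that by (simp add: csubspace_def)
  then show "scaleC c (orth_proj (K a) x) \<in> K a" by (simp add: orth_proj_in)
  show "rcinner z (scaleC c x) = rcinner z (scaleC c (orth_proj (K a) x))" if "z \<in> K a" for z
    using c[OF that] by (simp add: rcinner_scaleC_right orth_proj_orth)
qed

section \<open>Algebraic operations on local operators\<close>

lemma bloc_linear: "is_bloc K T \<Longrightarrow> linear T"
  unfolding is_bloc_def by (intro linearI) (auto, metis scaleC_of_real)

lemma bloc_scaleC: "is_bloc K T \<Longrightarrow> T (scaleC c x) = scaleC c (T x)"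
  by (simp add: is_bloc_def)

lemma bloc_in: "is_bloc K T \<Longrightarrow> x \<in> K a \<Longrightarrow> T x \<in> K a"
  unfolding is_bloc_def by blast

lemma bloc_bound:
  assumes "is_bloc K T"
  obtains C where "C > 0" "\<And>x. x \<in> K a \<Longrightarrow> norm (T x) \<le> C * norm x"
proof -
  have "\<exists>C. \<forall>x\<in>K a. norm (T x) \<le> C * norm x" using assms by (simp add: is_bloc_def)
  then obtain C where C: "\<forall>x\<in>K a. norm (T x) \<le> C * norm x" ..
  show ?thesis
  proof (rule that)
    show "max C 1 > 0" by simp
    show "norm (T x) \<le> max C 1 * norm x" if "x \<in> K a" for x
      using order_trans[OF bspec[OF C that] mult_right_mono[of C "max C 1" "norm x"]] by simp
  qed
qed

lemma bloc_proj: "is_bloc K T \<Longrightarrow> a \<le> b \<Longrightarrow> x \<in> K b \<Longrightarrow> orth_proj (K a) (T x) = T (orth_proj (K a) x)"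
  unfolding is_bloc_def by blast

lemma bloc_add: "is_bloc K S \<Longrightarrow> is_bloc K T \<Longrightarrow> is_bloc K (\<lambda>x. S x + T x)"
proof -
  assume S: "is_bloc K S" and T: "is_bloc K T"
  have "\<exists>C. \<forall>x\<in>K a. norm (S x + T x) \<le> C * norm x" for a
  proof -
    obtain C where C: "\<And>x. x \<in> K a \<Longrightarrow> norm (S x) \<le> C * norm x" using bloc_bound[OF S] by metis
    obtain E where E: "\<And>x. x \<in> K a \<Longrightarrow> norm (T x) \<le> E * norm x" using bloc_bound[OF T] by metis
    show ?thesis
      by (rule exI[of _ "C + E"]) (auto simp: algebra_simps intro!: norm_triangle_le add_mono C E)
  qed
  then show ?thesis
    using S T bloc_in[OF S] bloc_in[OF T] csubspace_add[OF sub_K]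
    by (auto simp: is_bloc_def orth_proj_add scaleC_add_right)
qed

lemma bloc_scaleR: "is_bloc K T \<Longrightarrow> is_bloc K (\<lambda>x. r *\<^sub>R T x)"
proof -
  assume T: "is_bloc K T"
  have "\<exists>C. \<forall>x\<in>K a. norm (r *\<^sub>R T x) \<le> C * norm x" for a
  proof -
    obtain C where C: "\<And>x. x \<in> K a \<Longrightarrow> norm (T x) \<le> C * norm x" using bloc_bound[OF T] by metis
    show ?thesis by (rule exI[of _ "\<bar>r\<bar> * C"]) (auto simp: mult.assoc intro!: mult_left_mono C)
  qed
  then show ?thesis
    using T bloc_in[OF T] csubspace_scaleR[OF sub_K] orth_proj_scaleC[of _ "of_real r"]
    by (auto simp: is_bloc_def scaleC_of_real scaleR_add_right)
       (simp add: scaleC_scaleC mult.commute flip: scaleC_of_real)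
qed

lemma bloc_comp: "is_bloc K S \<Longrightarrow> is_bloc K T \<Longrightarrow> is_bloc K (\<lambda>x. S (T x))"
proof -
  assume S: "is_bloc K S" and T: "is_bloc K T"
  have "\<exists>C. \<forall>x\<in>K a. norm (S (T x)) \<le> C * norm x" for a
  proof -
    obtain C where C: "C > 0" "\<And>x. x \<in> K a \<Longrightarrow> norm (S x) \<le> C * norm x" using bloc_bound[OF S] by metis
    obtain E where E: "\<And>x. x \<in> K a \<Longrightarrow> norm (T x) \<le> E * norm x" using bloc_bound[OF T] by metis
    have "norm (S (T x)) \<le> C * E * norm x" if "x \<in> K a" for x
      using C(2)[OF bloc_in[OF T that]] mult_left_mono[OF E[OF that], of C] C(1)
      by (simp only: mult.assoc) linarith
    then show ?thesis by blast
  qed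
  then show ?thesis
    using S T bloc_in[OF S] bloc_in[OF T] bloc_proj[OF S] bloc_proj[OF T]
    by (auto simp: is_bloc_def)
qed

section \<open>Local seminorms and adjoints\<close>

lemma loc_norm_le:
  assumes "M \<ge> 0" "\<And>x. x \<in> K a \<Longrightarrow> norm (T x) \<le> M * norm x"
  shows "loc_norm K T a \<le> M"
  unfolding loc_norm_def
proof (rule cSUP_least)
  show "{x \<in> K a. norm x \<le> 1} \<noteq> {}" using zero_K by force
  show "norm (T x) \<le> M" if "x \<in> {x \<in> K a. norm x \<le> 1}" for x
    using that assms(2)[of x] mult_left_mono[of "norm x" 1 M] assms(1) by (simp del: mult_le_cancel_left1)
qed

lemma norm_le_loc_norm:
  assumes T: "is_bloc K T" and x: "x \<in> K a"
  shows "norm (T x) \<le> loc_norm K T a * norm x"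
proof (cases "x = 0")
  case True
  then show ?thesis using bloc_linear[OF T] by (simp add: linear_0)
next
  case False
  obtain C where C: "C > 0" "\<And>x. x \<in> K a \<Longrightarrow> norm (T x) \<le> C * norm x" using bloc_bound[OF T] by metis
  define y where "y = inverse (norm x) *\<^sub>R x"
  have y: "y \<in> {x \<in> K a. norm x \<le> 1}"
    using x False csubspace_scaleR[OF sub_K] by (simp add: y_def)
  have "bdd_above ((\<lambda>x. norm (T x)) ` {x \<in> K a. norm x \<le> 1})"
  proof (rule bdd_aboveI2)
    show "norm (T x) \<le> C" if "x \<in> {x \<in> K a. norm x \<le> 1}" for x
      using that C(2)[of x] C(1) by (auto intro: order_trans[OF _ mult_left_le])
  qed
  then have "norm (T y) \<le> loc_norm K T a"
    unfolding loc_norm_def using y by (rule cSUP_upper2) simp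
  then show ?thesis
    using False bloc_linear[OF T] by (simp add: y_def linear_scale field_simps)
qed

text \<open>Riesz in one \<open>K a\<close> containing \<open>x\<close> gives a candidate.
  Commutation with the projections extends its defining identity to all of \<open>'h\<close>, so the
  candidate does not depend on \<open>a\<close> and the definite description is well
  defined.\<close>

lemma rcinner_bloc_adj:
  assumes T: "is_bloc K T"
  shows "rcinner (T z) x = rcinner z (bloc_adj K T x)"
proof -
  \<comment> \<open>For \<open>x\<close> and \<open>y\<close> in \<open>K a\<close>, both sides see
    only the projection of \<open>z\<close> to \<open>K a\<close>.\<close>
  have glob: "rcinner (T z) x = rcinner z y"
    if x: "x \<in> K a" and y: "y \<in> K a" and eq: "\<And>z. z \<in> K a \<Longrightarrow> rcinner (T z) x = rcinner z y" for a y z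
  proof -
    obtain b where b: "z \<in> K b" using finite_subset_K[of "{z}"] by auto
    obtain c where c: "a \<le> c" "b \<le> c" using finite_upper[of "{a, b}"] by auto
    then have z: "z \<in> K c" using b mono_K by blast
    have "rcinner (T z) x = rcinner x (orth_proj (K a) (T z))"
      using x by (simp add: orth_proj_orth rcinner_commute)
    also have "\<dots> = rcinner (T (orth_proj (K a) z)) x"
      by (simp add: bloc_proj[OF T c(1) z] rcinner_commute)
    also have "\<dots> = rcinner y (orth_proj (K a) z)"
      by (simp add: eq orth_proj_in rcinner_commute[of y])
    also have "\<dots> = rcinner z y" using y by (simp add: orth_proj_orth rcinner_commute)
    finally show ?thesis .
  qed
  \<comment> \<open>\<open>bloc_adj\<close> asks for the complex identity, whereas Riesz provides
    the real one; complex linearity of \<open>T\<close> closes the gap.\<close>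
  have conv: "\<forall>z\<in>K a. cinner (T z) x = cinner z y"
    if eq: "\<And>z. z \<in> K a \<Longrightarrow> rcinner (T z) x = rcinner z y" for a y
  proof
    fix z assume z: "z \<in> K a"
    then have "scaleC \<i> z \<in> K a" using sub_K by (simp add: csubspace_def)
    from eq[OF this] eq[OF z] show "cinner (T z) x = cinner z y"
      by (intro complex_eqI) (auto simp: Im_cinner bloc_scaleC[OF T] simp flip: rcinner_def)
  qed
  obtain a where x: "x \<in> K a" using finite_subset_K[of "{x}"] by auto
  obtain C where C: "C > 0" "\<And>x. x \<in> K a \<Longrightarrow> norm (T x) \<le> C * norm x" using bloc_bound[OF T] by metis
  have "rcinner (T z) x \<le> (C * norm x) * norm z" if "z \<in> K a" for z
    using rcinner_le[of "T z" x] mult_right_mono[OF C(2)[OF that], of "norm x"]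
    by (simp add: algebra_simps)
  then obtain y where y: "y \<in> K a" "\<And>z. z \<in> K a \<Longrightarrow> rcinner (T z) x = rcinner z y"
    using riesz[OF sub_K complete_K, where \<phi> = "\<lambda>z. rcinner (T z) x" and C = "C * norm x"]
      bloc_linear[OF T]
    by (auto simp: linear_add linear_scale rcinner.add_left rcinner.scaleR_left)
  have "bloc_adj K T x = y"
    unfolding bloc_adj_def
  proof (rule the_equality)
    show "\<exists>a. x \<in> K a \<and> y \<in> K a \<and> (\<forall>z\<in>K a. cinner (T z) x = cinner z y)"
      using x y(1) conv[OF y(2)] by blast
    fix y' assume "\<exists>a. x \<in> K a \<and> y' \<in> K a \<and> (\<forall>z\<in>K a. cinner (T z) x = cinner z y')"
    then obtain a' where "x \<in> K a'" "y' \<in> K a'" "\<And>z. z \<in> K a' \<Longrightarrow> rcinner (T z) x = rcinner z y'"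
      by (auto simp: rcinner_def)
    from glob[OF this] glob[OF x y] show "y' = y" by (intro rcinner_eqI) simp
  qed
  then show ?thesis using glob[OF x y] by simp
qed

lemma bloc_adj_eq_iff:
  assumes T: "is_bloc K T"
  shows "bloc_adj K T = T \<longleftrightarrow> (\<forall>x y. rcinner (T x) y = rcinner x (T y))"
proof
  assume "bloc_adj K T = T"
  then show "\<forall>x y. rcinner (T x) y = rcinner x (T y)" using rcinner_bloc_adj[OF T] by metis
next
  assume "\<forall>x y. rcinner (T x) y = rcinner x (T y)"
  then show "bloc_adj K T = T"
    using rcinner_bloc_adj[OF T] by (intro ext rcinner_eqI) metis
qed

text \<open>Equivalent to being fixed by \<open>bloc_adj\<close> (see
  \<open>bloc_adj_eq_iff\<close>), but free of the definite description and visibly stable under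
  pointwise limits.\<close>

definition selfadjoint :: "('h \<Rightarrow> 'h) \<Rightarrow> bool" where
  "selfadjoint T \<longleftrightarrow> is_bloc K T \<and> (\<forall>x y. rcinner (T x) y = rcinner x (T y))"

lemma selfadjoint_bloc: "selfadjoint T \<Longrightarrow> is_bloc K T"
  by (simp add: selfadjoint_def)

lemma selfadjoint_rcinner: "selfadjoint T \<Longrightarrow> rcinner (T x) y = rcinner x (T y)"
  by (simp add: selfadjoint_def)

lemma selfadjoint_scaleR: "selfadjoint T \<Longrightarrow> selfadjoint (\<lambda>x. r *\<^sub>R T x)"
  by (simp add: selfadjoint_def bloc_scaleR rcinner.scaleR_left rcinner.scaleR_right)

lemma mem_sa_part_iff: "X \<subseteq> {T. is_bloc K T} \<Longrightarrow> T \<in> sa_part K X \<longleftrightarrow> T \<in> X \<and> selfadjoint T"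
  using bloc_adj_eq_iff by (auto simp: sa_part_def selfadjoint_def)

section \<open>The transform \<open>S \<mapsto> 2 S (1 + S\<^sup>2)\<inverse>\<close>\<close>

lemma norm_one_plus_square:
  assumes "selfadjoint S"
  shows "(norm (x + S (S x)))\<^sup>2 = (norm x)\<^sup>2 + 2 * (norm (S x))\<^sup>2 + (norm (S (S x)))\<^sup>2"
  using selfadjoint_rcinner[OF assms, of x "S x"] by (simp add: norm_add_sq rcinner_self)

text \<open>The cross term 2 |S x|^2 is nonnegative. Hence 1+S^2 is injective, and both its inverse
  and S^2 times its inverse are contractions, whatever the norm of \<open>S\<close>.\<close>

lemma norm_le_one_plus_square:
  assumes "selfadjoint S"
  shows "norm x \<le> norm (x + S (S x))" and "norm (S (S x)) \<le> norm (x + S (S x))"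
  by (rule power2_le_imp_le; simp add: norm_one_plus_square[OF assms])+

text \<open>On \<open>K a\<close> one has 0 <= S^2 <= C^2, so with s = 1/(1+C^2) the operator 1 -
  s(1+S^2) lies between 0 and 1-s. The expansion of the squared norm proves this without spectral
  theory.\<close>

lemma richardson_contraction:
  assumes S: "selfadjoint S" and C: "\<And>x. x \<in> K a \<Longrightarrow> norm (S x) \<le> C * norm x" and y: "y \<in> K a"
  shows "norm (y - inverse (1 + C\<^sup>2) *\<^sub>R (y + S (S y))) \<le> (1 - inverse (1 + C\<^sup>2)) * norm y"
proof -
  define s where "s = inverse (1 + C\<^sup>2)"
  have pos: "0 < 1 + C\<^sup>2" by (simp add: add_pos_nonneg)
  \<comment> \<open>By the first identity the negative cross term has coefficient 2 s^2 C^2, twice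
    that of the bound for the last term.\<close>
  have s: "1 - s = s * C\<^sup>2" "0 < s" "s \<le> 1"
    using pos by (simp_all add: s_def field_simps)
  have "norm (S (S y)) \<le> C * norm (S y)" by (rule C[OF bloc_in[OF selfadjoint_bloc[OF S] y]])
  then have SS: "(norm (S (S y)))\<^sup>2 \<le> C\<^sup>2 * (norm (S y))\<^sup>2"
    by (metis norm_ge_zero power_mono power_mult_distrib)
  have "y - s *\<^sub>R (y + S (S y)) = (1 - s) *\<^sub>R y - s *\<^sub>R S (S y)" by (simp add: algebra_simps)
  then have "(norm (y - s *\<^sub>R (y + S (S y))))\<^sup>2
      = ((1 - s) * norm y)\<^sup>2 - 2 * (1 - s) * s * (norm (S y))\<^sup>2 + s\<^sup>2 * (norm (S (S y)))\<^sup>2"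
    using selfadjoint_rcinner[OF S, of y "S y"]
    by (simp add: norm_diff_sq power_mult_distrib rcinner.scaleR_left rcinner.scaleR_right rcinner_self)
  also have "\<dots> \<le> ((1 - s) * norm y)\<^sup>2 - 2 * (1 - s) * s * (norm (S y))\<^sup>2 + s\<^sup>2 * (C\<^sup>2 * (norm (S y))\<^sup>2)"
    using SS by (intro add_left_mono mult_left_mono) auto
  also have "\<dots> = ((1 - s) * norm y)\<^sup>2 - s\<^sup>2 * (C\<^sup>2 * (norm (S y))\<^sup>2)"
    by (simp add: s(1) power2_eq_square)
  also have "\<dots> \<le> ((1 - s) * norm y)\<^sup>2" by simp
  finally show ?thesis
    unfolding s_def[symmetric] by (rule power2_le_imp_le) (use s in simp)
qed

lemma resolvent_exists:
  assumes S: "selfadjoint S" and h: "h \<in> K a"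
  shows "\<exists>u\<in>K a. u + S (S u) = h"
proof -
  note lin = bloc_linear[OF selfadjoint_bloc[OF S]]
  obtain C where C: "\<And>x. x \<in> K a \<Longrightarrow> norm (S x) \<le> C * norm x"
    using bloc_bound[OF selfadjoint_bloc[OF S]] by metis
  define s where "s = inverse (1 + C\<^sup>2)"
  have pos: "0 < 1 + C\<^sup>2" by (simp add: add_pos_nonneg)
  have s: "0 < s" "s \<le> 1" using pos by (simp_all add: s_def field_simps)
  \<comment> \<open>Since \<open>s\<close> is nonzero, the fixed points are exactly the solutions;
    the contraction factor is 1-s.\<close>
  define f where "f u = u + s *\<^sub>R (h - (u + S (S u)))" for u
  have in_K: "S (S u) \<in> K a" if "u \<in> K a" for u
    using that by (intro bloc_in[OF selfadjoint_bloc[OF S]])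
  have "\<exists>!u\<in>K a. f u = u"
  proof (rule Banach_fix[OF complete_K, where c = "1 - s"])
    show "K a \<noteq> {}" using zero_K by blast
    show "f ` K a \<subseteq> K a"
      using h in_K sub_K[of a] by (auto simp: f_def intro!: csubspace_add csubspace_diff csubspace_scaleR)
    show "dist (f x) (f y) \<le> (1 - s) * dist x y" if "x \<in> K a" "y \<in> K a" for x y
    proof -
      have "f x - f y = (x - y) - s *\<^sub>R ((x - y) + S (S (x - y)))"
        by (simp add: f_def linear_diff[OF lin] algebra_simps)
      moreover have "x - y \<in> K a" using that csubspace_diff[OF sub_K] by blast
      ultimately show ?thesis
        using richardson_contraction[OF S C] by (simp add: dist_norm s_def)
    qed
  qed (use s in auto)
  then obtain u where "u \<in> K a" "f u = u" by blast
  then show ?thesis using s by (auto simp: f_def)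
qed

text \<open>The operator (1+S^2)^-1. Uniqueness on all of \<open>'h\<close> makes the solutions
  found in different \<open>K a\<close> agree.\<close>

definition resolvent :: "('h \<Rightarrow> 'h) \<Rightarrow> 'h \<Rightarrow> 'h" where
  "resolvent S h = (THE u. u + S (S u) = h)"

lemma resolvent_eqI:
  assumes S: "selfadjoint S" and u: "u + S (S u) = h"
  shows "resolvent S h = u"
  unfolding resolvent_def
proof (rule the_equality[where P = "\<lambda>u. u + S (S u) = h", OF u])
  fix v assume v: "v + S (S v) = h"
  have "(v - u) + S (S (v - u)) = 0"
    using u v by (simp add: linear_diff[OF bloc_linear[OF selfadjoint_bloc[OF S]]] algebra_simps)
  then show "v = u" using norm_le_one_plus_square(1)[OF S, of "v - u"] by simp
qed

lemma resolvent:
  assumes S: "selfadjoint S"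
  shows resolvent_in: "h \<in> K a \<Longrightarrow> resolvent S h \<in> K a"
    and resolvent_eq: "resolvent S h + S (S (resolvent S h)) = h"
proof -
  show "resolvent S h \<in> K a" if "h \<in> K a" for h a
    using resolvent_exists[OF S that] resolvent_eqI[OF S] by auto
  obtain a where "h \<in> K a" using finite_subset_K[of "{h}"] by auto
  from resolvent_exists[OF S this] show "resolvent S h + S (S (resolvent S h)) = h"
    using resolvent_eqI[OF S] by auto
qed

lemma norm_resolvent_le: "selfadjoint S \<Longrightarrow> norm (resolvent S h) \<le> norm h"
  using norm_le_one_plus_square(1)[of S "resolvent S h"] by (simp add: resolvent_eq)

text \<open>Sums, scalars and projections are all respected for one reason: \<open>S\<close>
  respects them, so the transformed solution solves the transformed equation, which has only one
  solution.\<close>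

lemma bloc_resolvent:
  assumes S: "selfadjoint S"
  shows "is_bloc K (resolvent S)"
proof -
  note bl = selfadjoint_bloc[OF S]
  note lin = bloc_linear[OF bl]
  note eq = resolvent_eq[OF S]
  have add: "resolvent S (x + y) = resolvent S x + resolvent S y" for x y
    using eq[of x] eq[of y] by (intro resolvent_eqI[OF S]) (simp add: linear_add[OF lin] algebra_simps)
  have scale: "resolvent S (scaleC c x) = scaleC c (resolvent S x)" for c x
    using eq[of x] by (intro resolvent_eqI[OF S]) (simp add: bloc_scaleC[OF bl] flip: scaleC_add_right)
  have proj: "orth_proj (K a) (resolvent S x) = resolvent S (orth_proj (K a) x)"
    if "a \<le> b" "x \<in> K b" for a b x
  proof -
    define u where "u = resolvent S x"
    have u: "u \<in> K b" "u + S (S u) = x" using that by (simp_all add: u_def resolvent_in[OF S] eq)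
    have "orth_proj (K a) u + S (S (orth_proj (K a) u)) = orth_proj (K a) x"
      using bloc_proj[OF bl that(1)] u bloc_in[OF bl] by (metis orth_proj_add)
    then show ?thesis unfolding u_def[symmetric] by (rule resolvent_eqI[OF S, symmetric])
  qed
  have bound: "\<exists>C. \<forall>x\<in>K a. norm (resolvent S x) \<le> C * norm x" for a
    by (rule exI[of _ 1]) (simp add: norm_resolvent_le[OF S])
  show ?thesis
    unfolding is_bloc_def using add scale proj bound resolvent_in[OF S] by (simp add: image_subset_iff)
qed

definition kaplansky :: "('h \<Rightarrow> 'h) \<Rightarrow> 'h \<Rightarrow> 'h" where
  "kaplansky S h = 2 *\<^sub>R S (resolvent S h)"

lemma bloc_kaplansky: "selfadjoint S \<Longrightarrow> is_bloc K (kaplansky S)"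
  unfolding kaplansky_def
  by (intro bloc_scaleR bloc_comp[of S "resolvent S"] bloc_resolvent selfadjoint_bloc)

lemma kaplansky_eqI: "selfadjoint S \<Longrightarrow> u + S (S u) = h \<Longrightarrow> kaplansky S h = 2 *\<^sub>R S u"
  by (simp add: kaplansky_def resolvent_eqI)

lemma selfadjoint_kaplansky:
  assumes S: "selfadjoint S"
  shows "selfadjoint (kaplansky S)"
proof -
  have "rcinner (kaplansky S x) y = rcinner x (kaplansky S y)" for x y
  proof -
    define u v where "u = resolvent S x" and "v = resolvent S y"
    have "x = u + S (S u)" "y = v + S (S v)"
      by (simp_all add: u_def v_def resolvent_eq[OF S])
    moreover have "kaplansky S x = 2 *\<^sub>R S u" "kaplansky S y = 2 *\<^sub>R S v"
      by (simp_all add: kaplansky_def u_def v_def)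
    ultimately show ?thesis
      by (simp add: rcinner.scaleR_left rcinner.scaleR_right rcinner.add_left rcinner.add_right
          selfadjoint_rcinner[OF S])
  qed
  then show ?thesis using bloc_kaplansky[OF S] by (simp add: selfadjoint_def)
qed

text \<open>For h = (1+S^2) u, the difference of the squared norms of \<open>h\<close> and
  \<open>kaplansky S h\<close> is |u - S^2 u|^2, the operator form of (1+t^2)^2 - (2t)^2 =
  (1-t^2)^2.\<close>

lemma norm_kaplansky_le:
  assumes S: "selfadjoint S"
  shows "norm (kaplansky S h) \<le> norm h"
proof -
  define u where "u = resolvent S h"
  have h: "h = u + S (S u)" by (simp add: u_def resolvent_eq[OF S])
  have "0 \<le> (norm (u - S (S u)))\<^sup>2" by simp
  also have "\<dots> = (norm u)\<^sup>2 - 2 * (norm (S u))\<^sup>2 + (norm (S (S u)))\<^sup>2"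
    using selfadjoint_rcinner[OF S, of u "S u"] by (simp add: norm_diff_sq rcinner_self)
  finally have "(norm (kaplansky S h))\<^sup>2 \<le> (norm h)\<^sup>2"
    using norm_one_plus_square[OF S, of u]
    by (simp add: h kaplansky_eqI[OF S refl] power_mult_distrib)
  then show ?thesis by (rule power2_le_imp_le) simp
qed

text \<open>The operator form of 2t^2/(1+t^2) <= 2. It absorbs an unbounded factor \<open>S\<close>
  in the continuity estimate.\<close>

lemma norm_kaplansky_comp_le:
  assumes S: "selfadjoint S"
  shows "norm (kaplansky S (S h)) \<le> 2 * norm h"
proof -
  define u where "u = resolvent S h"
  have h: "h = u + S (S u)" by (simp add: u_def resolvent_eq[OF S])
  have "S u + S (S (S u)) = S h"
    by (simp add: h linear_add[OF bloc_linear[OF selfadjoint_bloc[OF S]]])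
  then have "kaplansky S (S h) = 2 *\<^sub>R S (S u)" by (rule kaplansky_eqI[OF S])
  then show ?thesis using norm_le_one_plus_square(2)[OF S, of u] by (simp add: h)
qed

text \<open>An equation whose right-hand side lies in the algebra, unlike that of the resolvent;
  this is what makes it solvable there.\<close>

lemma kaplansky_plus_square:
  assumes S: "selfadjoint S"
  shows "kaplansky S x + S (S (kaplansky S x)) = 2 *\<^sub>R S x"
proof -
  note lin = bloc_linear[OF selfadjoint_bloc[OF S]]
  show ?thesis
    using arg_cong[OF resolvent_eq[OF S, of x], of S]
    by (simp add: kaplansky_def linear_add[OF lin] linear_scale[OF lin] flip: scaleR_add_right)
qed

text \<open>A resolvent identity: h = (1+S^2) u - (S-R) R u - S (S-R) u. The constants are
  independent of \<open>S\<close>, and \<open>S - R\<close> is evaluated only at \<open>u\<close>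
  and \<open>R u\<close>, which depend on \<open>R\<close> and \<open>h\<close> alone; this is SOT
  continuity at \<open>R\<close>. The 4 is 2 from the leading term plus 2 from
  \<open>norm_kaplansky_comp_le\<close>.\<close>

lemma norm_kaplansky_diff_le:
  fixes h :: 'h
  assumes S: "selfadjoint S" and R: "selfadjoint R"
  defines "u \<equiv> resolvent R h"
  shows "norm (kaplansky S h - kaplansky R h) \<le> 4 * norm (S u - R u) + norm (S (R u) - R (R u))"
proof -
  note lin = bloc_linear[OF selfadjoint_bloc[OF S]]
  note clin = bloc_linear[OF bloc_kaplansky[OF S]]
  have "h = u + R (R u)" by (simp add: u_def resolvent_eq[OF R])
  then have "h = (u + S (S u)) - (S (R u) - R (R u)) - S (S u - R u)"
    by (simp add: linear_diff[OF lin])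
  then have "kaplansky S h = 2 *\<^sub>R S u - kaplansky S (S (R u) - R (R u)) - kaplansky S (S (S u - R u))"
    by (metis linear_diff[OF clin] kaplansky_eqI[OF S refl])
  then have "kaplansky S h - kaplansky R h
      = 2 *\<^sub>R (S u - R u) - kaplansky S (S (R u) - R (R u)) - kaplansky S (S (S u - R u))"
    by (simp add: kaplansky_def[of R] u_def scaleR_diff_right)
  also have "norm \<dots> \<le> 2 * norm (S u - R u) + norm (S (R u) - R (R u)) + 2 * norm (S u - R u)"
    using norm_kaplansky_le[OF S, of "S (R u) - R (R u)"] norm_kaplansky_comp_le[OF S, of "S u - R u"]
    by (intro order_trans[OF norm_triangle_ineq4] add_mono) auto
  finally show ?thesis by simp
qed

lemma tendsto_kaplansky:
  assumes S: "\<And>n. selfadjoint (S n)" and R: "selfadjoint R"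
    and lim: "(\<lambda>n. S n (resolvent R h)) \<longlonglongrightarrow> R (resolvent R h)"
      "(\<lambda>n. S n (R (resolvent R h))) \<longlonglongrightarrow> R (R (resolvent R h))"
  shows "(\<lambda>n. kaplansky (S n) h) \<longlonglongrightarrow> kaplansky R h"
proof (rule LIM_zero_cancel, rule Lim_null_comparison[OF always_eventually])
  show "\<forall>n. norm (kaplansky (S n) h - kaplansky R h) \<le> 4 * norm (S n (resolvent R h) - R (resolvent R h))
      + norm (S n (R (resolvent R h)) - R (R (resolvent R h)))"
    using norm_kaplansky_diff_le[OF S R] by blast
  show "(\<lambda>n. 4 * norm (S n (resolvent R h) - R (resolvent R h))
      + norm (S n (R (resolvent R h)) - R (R (resolvent R h)))) \<longlonglongrightarrow> 0"
    using lim by (auto intro!: tendsto_eq_intros)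
qed

text \<open>Iterating \<open>R \<mapsto> T (1 + R\<^sup>2) / 2\<close>, whose fixed points solve \<open>kaplansky R = T\<close>.\<close>

primrec kaplansky_inv :: "('h \<Rightarrow> 'h) \<Rightarrow> nat \<Rightarrow> 'h \<Rightarrow> 'h" where
  "kaplansky_inv T 0 = (\<lambda>x. 0)"
| "kaplansky_inv T (Suc n) = (\<lambda>x. (1/2) *\<^sub>R T (x + kaplansky_inv T n (kaplansky_inv T n x)))"

section \<open>SOT closures described by sequences\<close>

lemma sot_closure_bloc: "sot_closure K X \<subseteq> {T. is_bloc K T}"
  by (auto simp: sot_closure_def)

lemma sot_closureD:
  "T \<in> sot_closure K X \<Longrightarrow> finite F \<Longrightarrow> \<epsilon> > 0 \<Longrightarrow> \<exists>S\<in>X. \<forall>h\<in>F. norm (T h - S h) < \<epsilon>"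
  by (simp add: sot_closure_def)

lemma sot_closure_mono: "X \<subseteq> Y \<Longrightarrow> sot_closure K X \<subseteq> sot_closure K Y"
  unfolding sot_closure_def by blast

text \<open>The SOT need not be metrisable, but once the finite test set is fixed, a sequence
  depending on that set suffices.\<close>

lemma sot_closure_seq:
  assumes "T \<in> sot_closure K X" "finite F"
  obtains S where "\<And>n. S n \<in> X" "\<And>h. h \<in> F \<Longrightarrow> (\<lambda>n. S n h) \<longlonglongrightarrow> T h"
proof -
  have "\<exists>S\<in>X. \<forall>h\<in>F. norm (T h - S h) < inverse (real (Suc n))" for n
    using assms by (simp add: sot_closure_def)
  then obtain S where S: "\<And>n. S n \<in> X" "\<And>n h. h \<in> F \<Longrightarrow> norm (T h - S n h) < inverse (real (Suc n))"
    by metis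
  have "(\<lambda>n. S n h) \<longlonglongrightarrow> T h" if "h \<in> F" for h
  proof (rule LIM_zero_cancel, rule Lim_null_comparison[OF always_eventually])
    show "\<forall>n. norm (S n h - T h) \<le> inverse (real (Suc n))"
      using S(2)[OF that] by (metis less_imp_le norm_minus_commute)
  qed (rule LIMSEQ_inverse_real_of_nat)
  with S(1) show ?thesis by (rule that)
qed

lemma sot_closure_seqI:
  assumes "is_bloc K T"
    and "\<And>F. finite F \<Longrightarrow> \<exists>S. (\<forall>n. S n \<in> X) \<and> (\<forall>h\<in>F. (\<lambda>n. S n h) \<longlonglongrightarrow> T h)"
  shows "T \<in> sot_closure K X"
proof -
  have "\<exists>S\<in>X. \<forall>h\<in>F. norm (T h - S h) < \<epsilon>" if "finite F" "\<epsilon> > 0" for F \<epsilon>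
  proof -
    obtain S where S: "\<And>n. S n \<in> X" "\<And>h. h \<in> F \<Longrightarrow> (\<lambda>n. S n h) \<longlonglongrightarrow> T h"
      using assms(2)[OF \<open>finite F\<close>] by blast
    then have "\<forall>\<^sub>F n in sequentially. \<forall>h\<in>F. dist (S n h) (T h) < \<epsilon>"
      using that by (auto intro!: eventually_ball_finite dest: tendstoD)
    then obtain n where "\<forall>h\<in>F. dist (S n h) (T h) < \<epsilon>"
      by (auto simp: eventually_sequentially)
    with S(1) show ?thesis by (metis dist_commute dist_norm)
  qed
  with assms(1) show ?thesis by (simp add: sot_closure_def)
qed

lemma sot_closure_sot_closure: "sot_closure K (sot_closure K X) \<subseteq> sot_closure K X"
proof
  fix T assume T: "T \<in> sot_closure K (sot_closure K X)"
  have "\<exists>S\<in>X. \<forall>h\<in>F. norm (T h - S h) < \<epsilon>" if F: "finite F" and e: "\<epsilon> > 0" for F \<epsilon>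
  proof -
    obtain R where R: "R \<in> sot_closure K X" "\<And>h. h \<in> F \<Longrightarrow> norm (T h - R h) < \<epsilon> / 2"
      using sot_closureD[OF T F half_gt_zero[OF e]] by blast
    obtain S where S: "S \<in> X" "\<And>h. h \<in> F \<Longrightarrow> norm (R h - S h) < \<epsilon> / 2"
      using sot_closureD[OF R(1) F half_gt_zero[OF e]] by blast
    have "norm (T h - S h) < \<epsilon>" if "h \<in> F" for h
      using norm_triangle_lt[of "T h - R h" "R h - S h" \<epsilon>] R(2)[OF that] S(2)[OF that] by simp
    with S(1) show ?thesis by blast
  qed
  moreover have "is_bloc K T" using T by (simp add: sot_closure_def)
  ultimately show "T \<in> sot_closure K X" by (simp add: sot_closure_def)
qed

end

section \<open>Density\<close>

locale locally_C_star_algebra = locally_hilbert_space K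
  for K :: "'i::preorder \<Rightarrow> 'h::complex_inner set" +
  fixes A :: "('h \<Rightarrow> 'h) set"
  assumes subalg: "locally_C_star_subalg K A"
begin

lemma A_bloc: "S \<in> A \<Longrightarrow> is_bloc K S"
  using subalg by (auto simp only: locally_C_star_subalg_def)

lemma A_zero: "(\<lambda>x. 0) \<in> A"
  using subalg by (simp add: locally_C_star_subalg_def)

lemma A_add: "S \<in> A \<Longrightarrow> T \<in> A \<Longrightarrow> (\<lambda>x. S x + T x) \<in> A"
  using subalg by (simp add: locally_C_star_subalg_def)

lemma A_adj: "T \<in> A \<Longrightarrow> bloc_adj K T \<in> A"
  using subalg by (simp add: locally_C_star_subalg_def)

lemma A_comp: "S \<in> A \<Longrightarrow> T \<in> A \<Longrightarrow> (\<lambda>x. S (T x)) \<in> A"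
  using subalg by (simp add: locally_C_star_subalg_def comp_def)

lemma A_scaleR:
  assumes "T \<in> A"
  shows "(\<lambda>x. r *\<^sub>R T x) \<in> A"
proof -
  have "\<forall>c. \<forall>T\<in>A. (\<lambda>x. scaleC c (T x)) \<in> A" using subalg by (simp add: locally_C_star_subalg_def)
  with assms have "(\<lambda>x. scaleC (complex_of_real r) (T x)) \<in> A" by blast
  then show ?thesis by (simp add: scaleC_of_real)
qed

lemma A_diff: "S \<in> A \<Longrightarrow> T \<in> A \<Longrightarrow> (\<lambda>x. S x - T x) \<in> A"
  using A_add[OF _ A_scaleR[of T "-1"], of S] by simp

text \<open>By directedness finitely many seminorms are dominated by a single one, so the
  approximant may be chosen for one \<open>K a\<close> at a time.\<close>

lemma A_closed:
  assumes T: "is_bloc K T"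
    and approx: "\<And>a \<epsilon>. \<epsilon> > 0 \<Longrightarrow> \<exists>S\<in>A. \<forall>x\<in>K a. norm (T x - S x) \<le> \<epsilon> * norm x"
  shows "T \<in> A"
proof -
  have "\<exists>S\<in>A. \<forall>a\<in>I. loc_norm K (\<lambda>x. T x - S x) a < \<epsilon>" if I: "finite I" and e: "\<epsilon> > 0" for I \<epsilon>
  proof -
    obtain c where c: "\<forall>a\<in>I. a \<le> c" using finite_upper[OF I] by blast
    obtain S where S: "S \<in> A" "\<forall>x\<in>K c. norm (T x - S x) \<le> \<epsilon> / 2 * norm x"
      using approx half_gt_zero[OF e] by blast
    have "loc_norm K (\<lambda>x. T x - S x) a < \<epsilon>" if "a \<in> I" for a
    proof -
      have "K a \<subseteq> K c" using c that mono_K by blast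
      then have "loc_norm K (\<lambda>x. T x - S x) a \<le> \<epsilon> / 2"
        using S(2) e by (intro loc_norm_le) auto
      with e show ?thesis by simp
    qed
    with S(1) show ?thesis by blast
  qed
  moreover have "\<forall>T. is_bloc K T \<and>
        (\<forall>F \<epsilon>. finite F \<longrightarrow> \<epsilon> > 0 \<longrightarrow> (\<exists>S\<in>A. \<forall>a\<in>F. loc_norm K (\<lambda>x. T x - S x) a < \<epsilon>))
        \<longrightarrow> T \<in> A"
    using subalg by (simp add: locally_C_star_subalg_def)
  ultimately show ?thesis using T by blast
qed

text \<open>The iterates stay in the algebra because they contain no constant term. The step size
  depends on the bound of \<open>S\<close> on \<open>K a\<close>, which is harmless since closedness
  is tested on one \<open>K a\<close> at a time.\<close>

lemma kaplansky_in_A: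
  assumes S: "selfadjoint S" and SA: "S \<in> A"
  shows "kaplansky S \<in> A"
proof (rule A_closed[OF bloc_kaplansky[OF S]])
  fix a and \<epsilon> :: real assume e: "\<epsilon> > 0"
  note lin = bloc_linear[OF selfadjoint_bloc[OF S]]
  obtain C where C: "\<And>x. x \<in> K a \<Longrightarrow> norm (S x) \<le> C * norm x"
    using bloc_bound[OF selfadjoint_bloc[OF S]] by metis
  define s where "s = inverse (1 + C\<^sup>2)"
  have pos: "0 < 1 + C\<^sup>2" by (simp add: add_pos_nonneg)
  have s: "0 < s" "s \<le> 1" using pos by (simp_all add: s_def field_simps)
  \<comment> \<open>Richardson iteration for the equation \<open>G + S\<^sup>2 G = 2 S\<close>, which \<open>kaplansky S\<close> solves\<close>
  define step where "step G x = G x + s *\<^sub>R (2 *\<^sub>R S x - (G x + S (S (G x))))" for G x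
  define G where "G n = (step ^^ n) (\<lambda>x. 0)" for n
  have GA: "G n \<in> A" for n
  proof (induction n)
    case (Suc n)
    have "step (G n) \<in> A"
      unfolding step_def by (intro A_add A_scaleR A_diff Suc A_comp[OF SA] SA)
    then show ?case by (simp add: G_def)
  qed (simp add: G_def A_zero)
  have err: "norm (kaplansky S x - G n x) \<le> (1 - s) ^ n * norm x" if x: "x \<in> K a" for n x
  proof (induction n)
    case 0
    then show ?case using norm_kaplansky_le[OF S] by (simp add: G_def)
  next
    case (Suc n)
    define y where "y = kaplansky S x - G n x"
    have "y \<in> K a"
      unfolding y_def using x by (intro csubspace_diff[OF sub_K] bloc_in[OF bloc_kaplansky[OF S]] bloc_in[OF A_bloc[OF GA]])
    have "kaplansky S x - G (Suc n) x = y - s *\<^sub>R (y + S (S y))"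
      by (simp add: G_def step_def y_def linear_diff[OF lin] algebra_simps
          flip: kaplansky_plus_square[OF S])
    then have "norm (kaplansky S x - G (Suc n) x) \<le> (1 - s) * norm y"
      using richardson_contraction[OF S C \<open>y \<in> K a\<close>] by (simp add: s_def)
    also have "\<dots> \<le> (1 - s) * ((1 - s) ^ n * norm x)"
      using Suc s by (intro mult_left_mono) (auto simp: y_def)
    finally show ?case by simp
  qed
  obtain n where "(1 - s) ^ n < \<epsilon>" using real_arch_pow_inv[OF e, of "1 - s"] s by auto
  then have "norm (kaplansky S x - G n x) \<le> \<epsilon> * norm x" if "x \<in> K a" for x
    using order_trans[OF err[OF that] mult_right_mono[of "(1 - s) ^ n" \<epsilon> "norm x"]] by simp
  with GA show "\<exists>S'\<in>A. \<forall>x\<in>K a. norm (kaplansky S x - S' x) \<le> \<epsilon> * norm x" by blast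
qed

section \<open>The SOT closure as an algebra\<close>

abbreviation SOT_A :: "('h \<Rightarrow> 'h) set" where
  "SOT_A \<equiv> sot_closure K A"

lemma A_in_SOT_A: "S \<in> A \<Longrightarrow> S \<in> SOT_A"
  by (intro sot_closure_seqI[OF A_bloc] exI[of _ "\<lambda>n. S"]) simp_all

lemma SOT_A_bloc: "T \<in> SOT_A \<Longrightarrow> is_bloc K T"
  using sot_closure_bloc by blast

lemma SOT_A_scaleR:
  assumes T: "T \<in> SOT_A"
  shows "(\<lambda>x. r *\<^sub>R T x) \<in> SOT_A"
proof (rule sot_closure_seqI)
  fix F :: "'h set" assume "finite F"
  from sot_closure_seq[OF T this] obtain S
    where "\<And>n. S n \<in> A" "\<And>h. h \<in> F \<Longrightarrow> (\<lambda>n. S n h) \<longlonglongrightarrow> T h" by metis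
  then show "\<exists>S. (\<forall>n. S n \<in> A) \<and> (\<forall>h\<in>F. (\<lambda>n. S n h) \<longlonglongrightarrow> r *\<^sub>R T h)"
    by (intro exI[of _ "\<lambda>n x. r *\<^sub>R S n x"]) (auto intro: A_scaleR tendsto_intros)
qed (rule bloc_scaleR[OF SOT_A_bloc[OF T]])

lemma SOT_A_add:
  assumes T: "T \<in> SOT_A" and R: "R \<in> SOT_A"
  shows "(\<lambda>x. T x + R x) \<in> SOT_A"
proof (rule sot_closure_seqI)
  fix F :: "'h set" assume F: "finite F"
  from sot_closure_seq[OF T F] obtain S
    where S: "\<And>n. S n \<in> A" "\<And>h. h \<in> F \<Longrightarrow> (\<lambda>n. S n h) \<longlonglongrightarrow> T h" by metis
  from sot_closure_seq[OF R F] obtain Q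
    where Q: "\<And>n. Q n \<in> A" "\<And>h. h \<in> F \<Longrightarrow> (\<lambda>n. Q n h) \<longlonglongrightarrow> R h" by metis
  from S Q show "\<exists>S. (\<forall>n. S n \<in> A) \<and> (\<forall>h\<in>F. (\<lambda>n. S n h) \<longlonglongrightarrow> T h + R h)"
    by (intro exI[of _ "\<lambda>n x. S n x + Q n x"]) (auto intro: A_add tendsto_intros)
qed (rule bloc_add[OF SOT_A_bloc[OF T] SOT_A_bloc[OF R]])

text \<open>Multiplication is only separately continuous for SOT, so the closure is taken twice.\<close>

lemma SOT_A_comp:
  assumes T: "T \<in> SOT_A" and R: "R \<in> SOT_A"
  shows "(\<lambda>x. T (R x)) \<in> SOT_A"
proof -
  \<comment> \<open>A fixed left factor is bounded on the \<open>K a\<close> containing the test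
    vectors, hence preserves the limits.\<close>
  have *: "(\<lambda>x. S (R x)) \<in> SOT_A" if S: "S \<in> A" for S
  proof (rule sot_closure_seqI)
    fix F :: "'h set" assume F: "finite F"
    obtain a where a: "F \<subseteq> K a" using finite_subset_K[OF F] .
    obtain C where C: "C > 0" "\<And>x. x \<in> K a \<Longrightarrow> norm (S x) \<le> C * norm x"
      using bloc_bound[OF A_bloc[OF S]] by metis
    from sot_closure_seq[OF R F] obtain Q
      where Q: "\<And>n. Q n \<in> A" "\<And>h. h \<in> F \<Longrightarrow> (\<lambda>n. Q n h) \<longlonglongrightarrow> R h" by metis
    have "(\<lambda>n. S (Q n h)) \<longlonglongrightarrow> S (R h)" if h: "h \<in> F" for h
    proof (rule LIM_zero_cancel, rule Lim_null_comparison[OF always_eventually])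
      have "Q n h - R h \<in> K a" for n
        using h a by (auto intro!: csubspace_diff[OF sub_K] bloc_in[OF A_bloc[OF Q(1)]] bloc_in[OF SOT_A_bloc[OF R]])
      then show "\<forall>n. norm (S (Q n h) - S (R h)) \<le> C * norm (Q n h - R h)"
        using C(2) by (simp flip: linear_diff[OF bloc_linear[OF A_bloc[OF S]]])
      show "(\<lambda>n. C * norm (Q n h - R h)) \<longlonglongrightarrow> 0"
        using Q(2)[OF h] by (auto intro!: tendsto_eq_intros)
    qed
    then show "\<exists>Q. (\<forall>n. Q n \<in> A) \<and> (\<forall>h\<in>F. (\<lambda>n. Q n h) \<longlonglongrightarrow> S (R h))"
      using Q(1) S by (intro exI[of _ "\<lambda>n x. S (Q n x)"]) (auto intro: A_comp)
  qed (rule bloc_comp[OF A_bloc[OF S] SOT_A_bloc[OF R]])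
  have "(\<lambda>x. T (R x)) \<in> sot_closure K SOT_A"
  proof (rule sot_closure_seqI)
    fix F :: "'h set" assume "finite F"
    then have "finite (R ` F)" by simp
    from sot_closure_seq[OF T this] obtain S
      where "\<And>n. S n \<in> A" "\<And>h. h \<in> R ` F \<Longrightarrow> (\<lambda>n. S n h) \<longlonglongrightarrow> T h" by metis
    then show "\<exists>S. (\<forall>n. S n \<in> SOT_A) \<and> (\<forall>h\<in>F. (\<lambda>n. S n h) \<longlonglongrightarrow> T (R h))"
      by (intro exI[of _ "\<lambda>n x. S n (R x)"]) (auto intro: *)
  qed (rule bloc_comp[OF SOT_A_bloc[OF T] SOT_A_bloc[OF R]])
  then show ?thesis using sot_closure_sot_closure by blast
qed

lemma bloc_adj_add_selfadjoint:
  assumes S: "S \<in> A"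
  shows "selfadjoint (\<lambda>x. S x + bloc_adj K S x)"
proof -
  note adj = rcinner_bloc_adj[OF A_bloc[OF S]]
  have "rcinner (bloc_adj K S x) y = rcinner x (S y)" for x y
    using adj[of y x] by (simp add: rcinner_commute)
  then show ?thesis
    using adj bloc_add[OF A_bloc A_bloc] S A_adj
    by (simp add: selfadjoint_def rcinner.add_left rcinner.add_right)
qed

text \<open>Projecting \<open>T\<close>, evaluated at \<open>F\<close>, to the closure of the evaluations of self-adjoint elements
  leaves a residual \<open>g\<close> such that \<open>S \<mapsto> \<Sum>h\<in>F. rcinner (g h) (S h + bloc_adj K S h)\<close>
  vanishes on \<open>A\<close>. In this functional the adjoint can be moved away from \<open>S\<close>, which makes it SOT
  continuous.\<close>

lemma sa_dense:
  assumes T: "T \<in> SOT_A" and sa: "selfadjoint T"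
  shows "T \<in> sot_closure K {S \<in> A. selfadjoint S}"
proof -
  define D where "D = {S \<in> A. selfadjoint S}"
  have "\<exists>S\<in>D. \<forall>h\<in>F. norm (T h - S h) < \<epsilon>" if F: "finite F" and e: "\<epsilon> > 0" for F \<epsilon>
  proof -
    obtain a where a: "F \<subseteq> K a" using finite_subset_K[OF F] .
    obtain w where w: "\<And>b. b \<in> F \<Longrightarrow> w b \<in> K a"
      and approx: "\<And>\<epsilon>. \<epsilon> > 0 \<Longrightarrow> \<exists>f\<in>D. \<forall>b\<in>F. norm (f b - w b) < \<epsilon>"
      and rep: "\<And>f. f \<in> D \<Longrightarrow> (\<Sum>h\<in>F. rcinner (T h) (f h)) = (\<Sum>b\<in>F. rcinner (w b) (f b))"
    \<comment> \<open>The quadratic functional is the squared distance to \<open>T\<close> on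
      \<open>F\<close>, minus the constant \<Sum> |T h|^2; hence the lower bound, and
      \<open>w\<close> is the projection of the evaluation of \<open>T\<close>.\<close>
    proof (rule riesz_family[of F "K a" D "\<lambda>f. \<Sum>h\<in>F. rcinner (T h) (f h)" "- (\<Sum>h\<in>F. (norm (T h))\<^sup>2)"], goal_cases)
      case 3
      have "(\<lambda>x. 0) \<in> D" using A_zero A_bloc by (simp add: D_def selfadjoint_def rcinner.zero_left rcinner.zero_right)
      then show ?case by blast
    next
      case (4 f b)
      then show ?case using a by (auto simp: D_def intro: bloc_in[OF A_bloc])
    next
      case (5 f g)
      then show ?case
        by (auto simp: D_def selfadjoint_def A_add bloc_add rcinner.add_left rcinner.add_right)
    next
      case (6 f r)
      then show ?case by (simp add: D_def A_scaleR selfadjoint_scaleR)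
    next
      case (9 f)
      have "0 \<le> (\<Sum>h\<in>F. (norm (f h - T h))\<^sup>2)" by (simp add: sum_nonneg)
      then show ?case
        by (simp add: norm_diff_sq sum.distrib sum_subtractf sum_distrib_left rcinner_commute[of "T _"])
    next
      case (10 w)
      then show ?case using that by blast
    qed (simp_all add: F complete_K rcinner.add_right rcinner.scaleR_right sum.distrib sum_distrib_left)
    define g where "g h = T h - w h" for h
    have orth: "(\<Sum>h\<in>F. rcinner (g h) (f h)) = 0" if "f \<in> D" for f
      using rep[OF that] by (simp add: g_def rcinner.diff_left sum_subtractf)
    have A0: "(\<Sum>h\<in>F. rcinner (g h) (S h) + rcinner (S (g h)) h) = 0" if S: "S \<in> A" for S
      using orth[of "\<lambda>x. S x + bloc_adj K S x"] S bloc_adj_add_selfadjoint[OF S] A_add[OF S A_adj[OF S]]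
      by (simp add: D_def rcinner.add_right rcinner_bloc_adj[OF A_bloc[OF S]])
    \<comment> \<open>Moving the adjoint makes \<open>S\<close> act on the vectors
      \<open>g h\<close>, so these must be tested as well.\<close>
    have "finite (F \<union> g ` F)" using F by simp
    from sot_closure_seq[OF T this] obtain S
      where S: "\<And>n. S n \<in> A" "\<And>h. h \<in> F \<union> g ` F \<Longrightarrow> (\<lambda>n. S n h) \<longlonglongrightarrow> T h" by metis
    have "(\<lambda>n. \<Sum>h\<in>F. rcinner (g h) (S n h) + rcinner (S n (g h)) h)
        \<longlonglongrightarrow> (\<Sum>h\<in>F. rcinner (g h) (T h) + rcinner (T (g h)) h)"
      by (intro tendsto_intros rcinner.tendsto S(2)) auto
    then have "(\<Sum>h\<in>F. rcinner (g h) (T h) + rcinner (T (g h)) h) = 0"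
      by (simp add: A0[OF S(1)] LIMSEQ_const_iff)
    \<comment> \<open>Self-adjointness of \<open>T\<close> makes the two summands equal, so the sum
      is twice the wanted one.\<close>
    then have gT: "(\<Sum>h\<in>F. rcinner (g h) (T h)) = 0"
      by (simp add: selfadjoint_rcinner[OF sa] flip: sum_distrib_left)
    have "\<exists>f\<in>D. \<forall>b\<in>F. norm (f b - w b) < inverse (real (Suc n))" for n
      by (rule approx) simp
    then obtain f where f: "\<And>n. f n \<in> D" "\<And>n b. b \<in> F \<Longrightarrow> norm (f n b - w b) < inverse (real (Suc n))"
      by metis
    have "(\<lambda>n. f n b) \<longlonglongrightarrow> w b" if "b \<in> F" for b
    proof (rule LIM_zero_cancel, rule Lim_null_comparison[OF always_eventually])
      show "\<forall>n. norm (f n b - w b) \<le> inverse (real (Suc n))" using f(2)[OF that] by (simp add: less_imp_le)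
    qed (rule LIMSEQ_inverse_real_of_nat)
    then have "(\<lambda>n. \<Sum>h\<in>F. rcinner (g h) (f n h)) \<longlonglongrightarrow> (\<Sum>h\<in>F. rcinner (g h) (w h))"
      by (intro tendsto_intros rcinner.tendsto) auto
    then have "(\<Sum>h\<in>F. rcinner (g h) (w h)) = 0"
      by (simp add: orth[OF f(1)] LIMSEQ_const_iff)
    \<comment> \<open>The residual is orthogonal to \<open>T\<close> and to \<open>w\<close>, hence
      to itself.\<close>
    with gT have "(\<Sum>h\<in>F. rcinner (g h) (T h - w h)) = 0"
      by (simp add: rcinner.diff_right sum_subtractf)
    then have "(\<Sum>h\<in>F. (norm (g h))\<^sup>2) = 0" by (simp add: rcinner_self flip: g_def)
    then have "w h = T h" if "h \<in> F" for h using that F by (simp add: sum_nonneg_eq_0_iff g_def)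
    with approx[OF e] show ?thesis by (metis norm_minus_commute)
  qed
  with SOT_A_bloc[OF T] show ?thesis by (simp add: sot_closure_def D_def)
qed

text \<open>The iterates are polynomials in \<open>T\<close> of norm at most \<open>r\<close>, since
  r(1+r^2)/2 <= r. On that ball x -> t(1+x^2)/2 has derivative t x, of modulus at most r^2 for |t|
  <= r, which explains the rate.\<close>

lemma kaplansky_inv:
  assumes T: "T \<in> SOT_A" "selfadjoint T" and r: "0 \<le> r" "r \<le> 1"
    and bd: "\<And>x. norm (T x) \<le> r * norm x"
  defines "R \<equiv> kaplansky_inv T"
  shows kaplansky_inv_SOT_A: "R n \<in> SOT_A"
    and kaplansky_inv_selfadjoint: "selfadjoint (R n)"
    and norm_kaplansky_inv_diff: "norm (R (Suc n) x - R n x) \<le> (r\<^sup>2) ^ n * norm x"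
proof -
  note lin = bloc_linear[OF SOT_A_bloc[OF T(1)]]
  have R0: "R 0 = (\<lambda>x. 0)" and RS: "R (Suc n) = (\<lambda>x. (1/2) *\<^sub>R T (x + R n (R n x)))" for n
    by (simp_all add: R_def)
  show mem: "R n \<in> SOT_A" for n
  proof (induction n)
    case (Suc n)
    have "(\<lambda>x. (1/2) *\<^sub>R (T x + T (R n (R n x)))) \<in> SOT_A"
      by (intro SOT_A_scaleR SOT_A_add SOT_A_comp[OF T(1)] SOT_A_comp[OF Suc] Suc T(1))
    then show ?case by (simp add: RS linear_add[OF lin])
  qed (simp add: R0 A_in_SOT_A A_zero)
  note linR = bloc_linear[OF SOT_A_bloc[OF mem]]
  \<comment> \<open>Commutation is needed because a product of self-adjoint operators is otherwise
    not self-adjoint.\<close>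
  have comm: "T (R n x) = R n (T x)" for n x
    by (induction n arbitrary: x) (simp_all add: R0 RS linear_0[OF lin] linear_add[OF lin] linear_scale[OF lin])
  show "selfadjoint (R n)" for n
  proof (induction n)
    case (Suc n)
    have "rcinner (R (Suc n) x) y = rcinner x (R (Suc n) y)" for x y
      by (simp add: RS linear_add[OF lin] rcinner.add_left rcinner.add_right rcinner.scaleR_left
          rcinner.scaleR_right selfadjoint_rcinner[OF T(2)] selfadjoint_rcinner[OF Suc] comm)
    then show ?case using SOT_A_bloc[OF mem] by (simp add: selfadjoint_def)
  qed (use SOT_A_bloc[OF mem[of 0]] in \<open>simp add: selfadjoint_def R0 rcinner.zero_left rcinner.zero_right\<close>)
  have Rle: "norm (R n x) \<le> r * norm x" for n x
  proof (induction n arbitrary: x)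
    case (Suc n)
    have "norm (R n (R n x)) \<le> r * (r * norm x)"
      using order_trans[OF Suc mult_left_mono[OF Suc r(1)]] .
    also have "\<dots> \<le> norm x"
      using r by (simp add: mult_le_one mult_left_le_one_le flip: mult.assoc)
    finally have "norm (x + R n (R n x)) \<le> 2 * norm x"
      by (intro norm_triangle_le) simp
    then have "norm (T (x + R n (R n x))) \<le> r * (2 * norm x)"
      using order_trans[OF bd mult_left_mono[OF _ r(1)]] by blast
    then show ?case by (simp add: RS)
  qed (simp add: R0 r)
  show "norm (R (Suc n) x - R n x) \<le> (r\<^sup>2) ^ n * norm x" for n x
  proof (induction n arbitrary: x)
    case 0
    then show ?case using Rle[of "Suc 0" x] mult_right_mono[OF r(2), of "norm x"] by (simp add: R0)
  next
    case (Suc n)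
    define P Q where "P = R (Suc n)" and "Q = R n"
    \<comment> \<open>P^2 - Q^2 = P(P-Q) + (P-Q)Q: each summand gains a factor \<open>r\<close>, the
      outer \<open>T\<close> a second one, and the 2 cancels against 1/2.\<close>
    have PP: "P (P x) - Q (Q x) = P (P x - Q x) + (P (Q x) - Q (Q x))"
      by (simp add: P_def linear_diff[OF linR])
    have "norm (P (P x - Q x)) \<le> r * ((r\<^sup>2) ^ n * norm x)"
      unfolding P_def Q_def using Rle mult_left_mono[OF Suc r(1)] by (rule order_trans)
    moreover have "norm (P (Q x) - Q (Q x)) \<le> (r\<^sup>2) ^ n * (r * norm x)"
      unfolding P_def Q_def using Suc mult_left_mono[OF Rle] by (rule order_trans) simp
    ultimately have "norm (P (P x) - Q (Q x)) \<le> 2 * (r * ((r\<^sup>2) ^ n * norm x))"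
      unfolding PP by (intro norm_triangle_le) (simp add: algebra_simps)
    then have "norm (T (P (P x) - Q (Q x))) \<le> r * (2 * (r * ((r\<^sup>2) ^ n * norm x)))"
      using order_trans[OF bd mult_left_mono[OF _ r(1)]] by blast
    moreover have "R (Suc (Suc n)) x - R (Suc n) x = (1/2) *\<^sub>R T (P (P x) - Q (Q x))"
      by (subst RS, subst (2) RS)
         (simp add: P_def Q_def linear_add[OF lin] linear_diff[OF lin] flip: scaleR_diff_right)
    ultimately show ?case by (simp add: power2_eq_square algebra_simps)
  qed
qed

text \<open>With h = (1+R_n^2) u, the recursion gives T h = 2 R_(n+1) u, while the transform of R_n
  at \<open>h\<close> is 2 R_n u. The defect is thus twice a difference of consecutive iterates, and
  no limit of the iterates has to be formed.\<close>

lemma norm_kaplansky_kaplansky_inv: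
  assumes T: "T \<in> SOT_A" "selfadjoint T" and r: "0 \<le> r" "r \<le> 1"
    and bd: "\<And>x. norm (T x) \<le> r * norm x"
  shows "norm (kaplansky (kaplansky_inv T n) h - T h) \<le> 2 * (r\<^sup>2) ^ n * norm h"
proof -
  define R where "R = kaplansky_inv T"
  have sa: "selfadjoint (R n)" unfolding R_def by (rule kaplansky_inv_selfadjoint[OF assms])
  define u where "u = resolvent (R n) h"
  have "h = u + R n (R n u)" by (simp add: u_def resolvent_eq[OF sa])
  then have "T h = 2 *\<^sub>R R (Suc n) u" by (simp add: R_def)
  then have "kaplansky (R n) h - T h = - (2 *\<^sub>R (R (Suc n) u - R n u))"
    by (simp add: kaplansky_def u_def scaleR_diff_right)
  then have "norm (kaplansky (R n) h - T h) = 2 * norm (R (Suc n) u - R n u)"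
    by (simp only: norm_minus_cancel norm_scaleR)
  also have "\<dots> \<le> 2 * ((r\<^sup>2) ^ n * norm u)"
    using norm_kaplansky_inv_diff[OF assms, of n u] by (simp add: R_def)
  also have "\<dots> \<le> 2 * ((r\<^sup>2) ^ n * norm h)"
    unfolding u_def by (intro mult_left_mono norm_resolvent_le[OF sa]) auto
  finally show ?thesis by (simp add: R_def mult.assoc)
qed

lemma contraction_dense:
  assumes T: "T \<in> SOT_A" "selfadjoint T" and bd: "\<And>x. norm (T x) \<le> norm x"
  shows "T \<in> sot_closure K {S \<in> A. selfadjoint S \<and> (\<forall>x. norm (S x) \<le> norm x)}"
    (is "_ \<in> sot_closure K ?B")
proof -
  \<comment> \<open>\<open>sa_dense\<close> gives approximants of \<open>R\<close> of uncontrolled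
    norm; their transforms are contractions. \<open>G\<close> collects the vectors at which the
    continuity estimate tests them.\<close>
  have kap: "kaplansky R \<in> sot_closure K ?B" if R: "R \<in> SOT_A" "selfadjoint R" for R
  proof (rule sot_closure_seqI[OF bloc_kaplansky[OF R(2)]])
    fix F :: "'h set" assume F: "finite F"
    define G where "G = resolvent R ` F \<union> R ` resolvent R ` F"
    have "finite G" using F by (simp add: G_def)
    from sot_closure_seq[OF sa_dense[OF R] this] obtain S
      where "\<And>n. S n \<in> {S \<in> A. selfadjoint S}" "\<And>h. h \<in> G \<Longrightarrow> (\<lambda>n. S n h) \<longlonglongrightarrow> R h"
      by blast
    then have S: "\<And>n. S n \<in> A" "\<And>n. selfadjoint (S n)" "\<And>h. h \<in> G \<Longrightarrow> (\<lambda>n. S n h) \<longlonglongrightarrow> R h"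
      by simp_all
    have "(\<lambda>n. kaplansky (S n) h) \<longlonglongrightarrow> kaplansky R h" if "h \<in> F" for h
      using that by (intro tendsto_kaplansky S R) (auto simp: G_def)
    then show "\<exists>S. (\<forall>n. S n \<in> ?B) \<and> (\<forall>h\<in>F. (\<lambda>n. S n h) \<longlonglongrightarrow> kaplansky R h)"
      using S(1,2)
      by (intro exI[of _ "\<lambda>n. kaplansky (S n)"])
         (simp add: kaplansky_in_A selfadjoint_kaplansky norm_kaplansky_le)
  qed
  have strict: "(\<lambda>x. r *\<^sub>R T x) \<in> sot_closure K ?B" if r: "0 \<le> r" "r < 1" for r
  proof -
    define Q where "Q = (\<lambda>x. r *\<^sub>R T x)"
    have Q: "Q \<in> SOT_A" "selfadjoint Q" "\<And>x. norm (Q x) \<le> r * norm x"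
      using T r bd by (simp_all add: Q_def SOT_A_scaleR selfadjoint_scaleR mult_left_mono)
    note facts = Q(1,2) r(1) less_imp_le[OF r(2)] Q(3)
    have r2: "r\<^sup>2 < 1" using r by (simp add: power_less_one_iff abs_square_less_1)
    have "(\<lambda>n. kaplansky (kaplansky_inv Q n) h) \<longlonglongrightarrow> Q h" for h
    proof (rule LIM_zero_cancel, rule Lim_null_comparison[OF always_eventually])
      show "\<forall>n. norm (kaplansky (kaplansky_inv Q n) h - Q h) \<le> 2 * (r\<^sup>2) ^ n * norm h"
        using norm_kaplansky_kaplansky_inv[OF facts] by blast
      show "(\<lambda>n. 2 * (r\<^sup>2) ^ n * norm h) \<longlonglongrightarrow> 0"
        using r2 by (auto intro!: tendsto_eq_intros LIMSEQ_power_zero)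
    qed
    moreover have "kaplansky (kaplansky_inv Q n) \<in> sot_closure K ?B" for n
      by (intro kap kaplansky_inv_SOT_A[OF facts] kaplansky_inv_selfadjoint[OF facts])
    ultimately have "Q \<in> sot_closure K (sot_closure K ?B)"
      by (intro sot_closure_seqI[OF SOT_A_bloc[OF Q(1)]] exI[of _ "\<lambda>n. kaplansky (kaplansky_inv Q n)"]) simp
    then show ?thesis using sot_closure_sot_closure unfolding Q_def by blast
  qed
  have "(\<lambda>n. (1 - inverse (real (Suc n))) *\<^sub>R T h) \<longlonglongrightarrow> (1 - 0) *\<^sub>R T h" for h
    by (intro tendsto_intros LIMSEQ_inverse_real_of_nat)
  moreover have "(\<lambda>x. (1 - inverse (real (Suc n))) *\<^sub>R T x) \<in> sot_closure K ?B" for n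
    by (rule strict) (simp_all add: field_simps)
  ultimately have "T \<in> sot_closure K (sot_closure K ?B)"
    by (intro sot_closure_seqI[OF SOT_A_bloc[OF T(1)]]
        exI[of _ "\<lambda>n x. (1 - inverse (real (Suc n))) *\<^sub>R T x"]) simp
  then show ?thesis using sot_closure_sot_closure by blast
qed

lemma bounded_dense:
  assumes T: "T \<in> SOT_A" "selfadjoint T" and M: "M > 0" and bd: "\<And>x. norm (T x) \<le> M * norm x"
  shows "T \<in> sot_closure K {S \<in> A. selfadjoint S \<and> (\<forall>x. norm (S x) \<le> M * norm x)}"
proof (rule sot_closure_seqI[OF SOT_A_bloc[OF T(1)]])
  fix F :: "'h set" assume F: "finite F"
  define Q where "Q = (\<lambda>x. inverse M *\<^sub>R T x)"
  have "Q \<in> sot_closure K {S \<in> A. selfadjoint S \<and> (\<forall>x. norm (S x) \<le> norm x)}"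
    unfolding Q_def using T M bd
    by (intro contraction_dense SOT_A_scaleR selfadjoint_scaleR) (simp_all add: field_simps)
  from sot_closure_seq[OF this F] obtain S
    where "\<And>n. S n \<in> {S \<in> A. selfadjoint S \<and> (\<forall>x. norm (S x) \<le> norm x)}"
      "\<And>h. h \<in> F \<Longrightarrow> (\<lambda>n. S n h) \<longlonglongrightarrow> Q h"
      by blast
  then have S: "\<And>n. S n \<in> A" "\<And>n. selfadjoint (S n)" "\<And>n x. norm (S n x) \<le> norm x"
      "\<And>h. h \<in> F \<Longrightarrow> (\<lambda>n. S n h) \<longlonglongrightarrow> Q h"
    by simp_all
  have "(\<lambda>n. M *\<^sub>R S n h) \<longlonglongrightarrow> T h" if "h \<in> F" for h
    using tendsto_scaleR[OF tendsto_const S(4)[OF that], of M] M by (simp add: Q_def)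
  then show "\<exists>S. (\<forall>n. S n \<in> {S \<in> A. selfadjoint S \<and> (\<forall>x. norm (S x) \<le> M * norm x)}) \<and>
      (\<forall>h\<in>F. (\<lambda>n. S n h) \<longlonglongrightarrow> T h)"
    using S(1-3) M
    by (intro exI[of _ "\<lambda>n x. M *\<^sub>R S n x"]) (simp add: A_scaleR selfadjoint_scaleR)
qed

text \<open>The easy inclusion of (2): symmetry and the norm bound involve at most two vectors, so
  they pass to pointwise limits.\<close>

lemma sot_closure_bounded:
  assumes T: "T \<in> sot_closure K {S \<in> A. selfadjoint S \<and> (\<forall>x. norm (S x) \<le> M * norm x)}"
  shows "selfadjoint T" and "norm (T x) \<le> M * norm x"
proof -
  have *: "rcinner (T x) y = rcinner x (T y) \<and> norm (T x) \<le> M * norm x" for x y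
  proof -
    have "finite {x, y}" by simp
    from sot_closure_seq[OF T this] obtain S
      where "\<And>n. S n \<in> {S \<in> A. selfadjoint S \<and> (\<forall>x. norm (S x) \<le> M * norm x)}"
        "\<And>h. h \<in> {x, y} \<Longrightarrow> (\<lambda>n. S n h) \<longlonglongrightarrow> T h"
      by blast
    then have S: "\<And>n. selfadjoint (S n)" "\<And>n x. norm (S n x) \<le> M * norm x"
      and lim: "(\<lambda>n. S n x) \<longlonglongrightarrow> T x" "(\<lambda>n. S n y) \<longlonglongrightarrow> T y"
      by simp_all
    have "(\<lambda>n. rcinner (S n x) y) \<longlonglongrightarrow> rcinner (T x) y"
      "(\<lambda>n. rcinner x (S n y)) \<longlonglongrightarrow> rcinner x (T y)"
      by (intro rcinner.tendsto tendsto_const lim)+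
    then have "rcinner (T x) y = rcinner x (T y)"
      using LIMSEQ_unique by (simp add: selfadjoint_rcinner[OF S(1)])
    moreover have "norm (T x) \<le> M * norm x"
      using tendsto_norm[OF lim(1)] by (rule LIMSEQ_le_const2) (use S(2) in blast)
    ultimately show ?thesis ..
  qed
  then show "norm (T x) \<le> M * norm x" by blast
  have "is_bloc K T" using T by (simp add: sot_closure_def)
  with * show "selfadjoint T" by (simp add: selfadjoint_def)
qed

text \<open>Since the \<open>K a\<close> cover \<open>'h\<close>, a bound uniform in
  \<open>a\<close> is a single global bound, in which form the density arguments use it.\<close>

lemma loc_norm_le_iff:
  assumes "is_bloc K T" "M \<ge> 0"
  shows "(\<forall>a. loc_norm K T a \<le> M) \<longleftrightarrow> (\<forall>x. norm (T x) \<le> M * norm x)"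
proof (intro iffI allI)
  fix x assume le: "\<forall>a. loc_norm K T a \<le> M"
  obtain a where "x \<in> K a" using finite_subset_K[of "{x}"] by auto
  then have "norm (T x) \<le> loc_norm K T a * norm x" by (rule norm_le_loc_norm[OF assms(1)])
  also have "\<dots> \<le> M * norm x" using le by (simp add: mult_right_mono)
  finally show "norm (T x) \<le> M * norm x" .
next
  fix a assume "\<forall>x. norm (T x) \<le> M * norm x"
  then show "loc_norm K T a \<le> M" using assms(2) by (intro loc_norm_le) auto
qed

end

theorem mainTheorem5:
  fixes K :: "'i::preorder \<Rightarrow> 'h::complex_inner set" and A :: "('h \<Rightarrow> 'h) set"
  assumes "locally_hilbert K" and "locally_C_star_subalg K A"
  shows "sa_part K (sot_closure K A) \<subseteq> sot_closure K (sa_part K A) \<and>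
         (\<forall>M::real. M > 0 \<longrightarrow>
           sot_closure K {S \<in> sa_part K A. \<forall>a. loc_norm K S a \<le> M}
         = {T \<in> sa_part K (sot_closure K A). \<forall>a. loc_norm K T a \<le> M})"
proof -
  interpret locally_C_star_algebra K A using assms by unfold_locales
  have A: "A \<subseteq> {T. is_bloc K T}" using A_bloc by blast
  have saA: "sa_part K A = {S \<in> A. selfadjoint S}"
    and saS: "sa_part K (sot_closure K A) = {T \<in> sot_closure K A. selfadjoint T}"
    by (simp_all add: set_eq_iff mem_sa_part_iff[OF A] mem_sa_part_iff[OF sot_closure_bloc])
  have "sot_closure K {S \<in> sa_part K A. \<forall>a. loc_norm K S a \<le> M}
      = {T \<in> sa_part K (sot_closure K A). \<forall>a. loc_norm K T a \<le> M}" if M: "M > 0" for M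
  proof -
    define B where "B = {S \<in> A. selfadjoint S \<and> (\<forall>x. norm (S x) \<le> M * norm x)}"
    have eqB: "{S \<in> sa_part K A. \<forall>a. loc_norm K S a \<le> M} = B"
      unfolding saA B_def using loc_norm_le_iff[OF A_bloc less_imp_le[OF M]] by blast
    have eqT: "{T \<in> sa_part K (sot_closure K A). \<forall>a. loc_norm K T a \<le> M}
        = {T \<in> SOT_A. selfadjoint T \<and> (\<forall>x. norm (T x) \<le> M * norm x)}"
      unfolding saS using loc_norm_le_iff[OF SOT_A_bloc less_imp_le[OF M]] by blast
    have "sot_closure K B \<subseteq> SOT_A" by (rule sot_closure_mono) (auto simp: B_def)
    then show ?thesis
      unfolding eqB eqT using sot_closure_bounded bounded_dense[OF _ _ M] unfolding B_def by blast
  qed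
  moreover have "sa_part K (sot_closure K A) \<subseteq> sot_closure K (sa_part K A)"
    unfolding saA saS using sa_dense by blast
  ultimately show ?thesis by blast
qed

end
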